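(* Let $f:\mathbb{R}^n\to\mathbb{R}$ be continuously differentiable and $\varphi:\mathbb{R}^n\to(-\infty,+\infty]$ convex, lower semicontinuous and proper. Consider the stochastic extra-step method described in the context with $\Lambda_k=\lambda_k^{-1}I$, $\lambda_k>0$, and suppose that the matrices $(W_k)_k$ (with corresponding stochastic process $(\mathsf W_k)_k$) and the directions $d^k=-W_kF^{\Lambda_k}_{v^k}(x^k)$ (with corresponding stochastic process $(\mathsf D^k)_k$) are generated by the coordinate L-BFGS scheme described in the context, with memory $p\in\mathbb{N}$ and parameters $\delta,\delta_1>0$, $\delta_2=10^{-6}$ and $\zeta_k>0$. Assume: (D.1) $(\Upsilon,\mathcal U)$ is a measurable space, $\mathsf V:\mathbb{R}^n\times\Upsilon\to\mathbb{R}^n$ is a Carathéodory function, and for all $k$ the oracles are generated as $\mathsf V^k(\omega)=\mathsf V(\mathsf X^k(\omega),\Xi^k(\omega))$ and $\mathsf V^k_+(\omega)=\mathsf V(\mathsf Z^k(\omega),\Xi^k_+(\omega))$ for all $\omega\in\Omega$, where $\Xi^k,\Xi^k_+:\Omega\to\Upsilon$ are $(\mathcal F,\mathcal U)$-measurable random variables; (D.2) there exist a random variable $\mathsf L:\Upsilon\to\mathbb{R}$ and $\bar\ell>0$ such that $\|\mathsf V(x,u)-\mathsf V(y,u)\|\le\mathsf L(u)\|x-y\|$ for all $u\in\Upsilon$ and $x,y\in\mathbb{R}^n$, and $\sup_{k}\lambda_k\mathsf L(\Xi^k(\omega))\le\bar\ell$ almost surely; and $|\zeta_k|\le\bar\zeta$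 for some $\bar\zeta>0$ and all $k$. Then there exists a constant $\bar\nu\equiv\bar\nu(\bar\ell,p,\delta_1,\bar\zeta)$, depending only on $\bar\ell,p,\delta_1,\bar\zeta$, such that almost surely $$\|\mathsf W_k\|\le\bar\nu\qquad\text{and}\qquad\|\mathsf D^k\|\le\bar\nu\cdot\|F^{\Lambda_k}_{\mathsf V^k}(\mathsf X^k)\|\qquad\text{for all }k .$$
   Context: $\|\cdot\|$ is the Euclidean norm for vectors and the spectral norm for matrices. For symmetric positive definite $\Lambda$, $\mathrm{prox}^\Lambda_\varphi(x)=\mathrm{argmin}_y\,\varphi(y)+\frac12\langle x-y,\Lambda(x-y)\rangle$ and $F^\Lambda_v(x):=x-\mathrm{prox}^\Lambda_\varphi(x-\Lambda^{-1}v)$. Stochastic extra-step method on a probability space $(\Omega,\mathcal F,\mathbb P)$: $x^0\in\mathrm{dom}\,\varphi$; for $k=0,1,\dots$, with an oracle $v^k\approx\nabla f(x^k)$ choose a direction $d^k$, set $z^k=x^k+\beta_kd^k$, and with an oracle $v^k_+\approx\nabla f(z^k)$ set $x^{k+1}=\mathrm{prox}^{\Lambda_{k,+}}_\varphi(x^k+\alpha_kd^k-\Lambda_{k,+}^{-1}v^k_+)$, where $\alpha_k,\beta_k\ge0$ and $\Lambda_{k,+}$ is symmetric positive definite. Sans-serif letters $\mathsf X^k,\mathsf Z^k,\mathsf V^k,\mathsf V^k_+,\mathsf D^k,\mathsf W_k$ denote the random variables whose realizations are $x^k,z^k,v^k,v^k_+,d^k,W_k$; $\xi^k$ is the realization of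 $\Xi^k$. Curvature pairs: $u_k=z^k-x^k$, $y_k=F^{\Lambda_k}_{v^k_z}(z^k)-F^{\Lambda_k}_{v^k}(x^k)$, where $v^k_z:=\mathsf V(z^k,\xi^k)$ (the same sample $\xi^k$ as in $v^k=\mathsf V(x^k,\xi^k)$). A pair is stored only if $\langle u_k,y_k\rangle\ge\delta\|u_k\|^2$. At iteration $k$, the $p$ most recent stored pairs are used. L-BFGS matrix from an ordered list of pairs $(\bar u_1,\bar y_1),\dots,(\bar u_q,\bar y_q)$ (most recent last): $\bar W^0=\gamma I$ with $\gamma=\langle\bar u_q,\bar y_q\rangle/\langle\bar y_q,\bar y_q\rangle$; $\bar W^{i}=(I-\rho_i\bar u_i\bar y_i^\top)\bar W^{i-1}(I-\rho_i\bar y_i\bar u_i^\top)+\rho_i\bar u_i\bar u_i^\top$ with $\rho_i=1/\langle\bar y_i,\bar u_i\rangle$, $i=1,\dots,q$; the result is $\bar W^q$. (The formulas presuppose nonzero denominators.) Coordinate L-BFGS scheme: let $\mathcal I=\{i\in\{1,\dots,n\}:|(F^{\Lambda_k}_{v^k}(x^k))_i|\ge\delta_2\}$ and $\mathcal A=\{1,\dots,n\}\setminus\mathcal I$. Let $\mathcal Q$ be the set of those used pairs $(u,y)$ with $|\langle u_{\mathcal I},y_{\mathcal I}\rangle|\ge\delta_1\|u\|^2$, where $u_{\mathcal I},y_{\mathcal I}$ are the subvectors indexed by $\mathcal I$. If $\mathcal Q\neq\emptyset$, then $W_{\mathcal I\mathcal I}$ is the L-BFGS matrix built from the restricted pairs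 $(u_{\mathcal I},y_{\mathcal I})$, $(u,y)\in\mathcal Q$, and $W_k$ is the block-diagonal matrix with block $W_{\mathcal I\mathcal I}$ on the coordinates $\mathcal I$ and block $\zeta_kI$ on the coordinates $\mathcal A$. If $\mathcal Q=\emptyset$, then $\mathcal I$ is reset to $\{1,\dots,n\}$ and $W_k=W_{\mathcal I\mathcal I}$ is the full L-BFGS matrix built from the pairs $(u,y)$ used at iteration $k$.
   Formalization: The constant depends on min(δ,δ1) in place of δ1 (same if δ1 ≤ δ); for δ<δ1 the claim fails: n=1, φ=0, V(x,u)=δx, δ1=1 gives W=1/δ. It is stated for fixed carriers of Ω and Υ; a pathwise reduction removes this. With empty memory the L-BFGS matrix is taken to be I. *)

theory Defs
  imports
    "HOL-Probability.Probability"
    "HOL-Library.Function_Algebras"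
begin

text \<open>
  The constant of the theorem must not depend on the dimension \<open>n\<close>, so \<open>n\<close> has to be quantified
  inside a formula and cannot be a type. We use the library's space \<^const>\<open>Euclidean_space\<close>: the
  sequences \<open>x :: nat \<Rightarrow> real\<close> with \<open>x i = 0\<close> for \<open>i \<ge> n\<close>. Coordinates are \<open>0, \<dots>, n - 1\<close>. Vectors and
  matrices indexed by a set \<open>I\<close> of coordinates are functions on \<^typ>\<open>nat\<close>, and all sums below run
  over \<open>I\<close>.
\<close>

type_synonym rvec = "nat \<Rightarrow> real"
type_synonym rmat = "nat \<Rightarrow> nat \<Rightarrow> real"

abbreviation Rn :: "nat \<Rightarrow> rvec set" where
  "Rn n \<equiv> topspace (Euclidean_space n)"

definition vscale :: "real \<Rightarrow> rvec \<Rightarrow> rvec" where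
  "vscale c x = (\<lambda>i. c * x i)"

definition inner_on :: "nat set \<Rightarrow> rvec \<Rightarrow> rvec \<Rightarrow> real" where
  "inner_on I x y = (\<Sum>i\<in>I. x i * y i)"

abbreviation vnorm :: "nat \<Rightarrow> rvec \<Rightarrow> real" where
  "vnorm n x \<equiv> L2_set x {..<n}"

definition subvec :: "nat set \<Rightarrow> rvec \<Rightarrow> rvec" where
  "subvec I x = (\<lambda>i. if i \<in> I then x i else 0)"

definition mat_scale :: "real \<Rightarrow> rmat \<Rightarrow> rmat" where
  "mat_scale c A = (\<lambda>i j. c * A i j)"

definition mat_id :: "nat set \<Rightarrow> rmat" where
  "mat_id I = (\<lambda>i j. if i = j \<and> i \<in> I then 1 else 0)"

definition mat_vec :: "nat set \<Rightarrow> rmat \<Rightarrow> rvec \<Rightarrow> rvec" where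
  "mat_vec I A x = (\<lambda>i. \<Sum>j\<in>I. A i j * x j)"

definition mat_mult :: "nat set \<Rightarrow> rmat \<Rightarrow> rmat \<Rightarrow> rmat" where
  "mat_mult I A B = (\<lambda>i j. \<Sum>k\<in>I. A i k * B k j)"

definition outer :: "rvec \<Rightarrow> rvec \<Rightarrow> rmat" where
  "outer x y = (\<lambda>i j. x i * y j)"

definition spectral_norm :: "nat \<Rightarrow> rmat \<Rightarrow> real" where
  "spectral_norm n A =
     Sup {vnorm n (mat_vec {..<n} A x) | x. x \<in> Rn n \<and> vnorm n x \<le> 1}"

definition sym_pos_def :: "nat \<Rightarrow> rmat \<Rightarrow> bool" where
  "sym_pos_def n A \<longleftrightarrow>
     (\<forall>i<n. \<forall>j<n. A i j = A j i) \<and>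
     (\<forall>x\<in>Rn n. x \<noteq> 0 \<longrightarrow> inner_on {..<n} x (mat_vec {..<n} A x) > 0)"

text \<open>The entries outside the \<open>n \<times> n\<close> block are fixed to be 0, which makes the inverse unique.\<close>

definition mat_inverse :: "nat \<Rightarrow> rmat \<Rightarrow> rmat" where
  "mat_inverse n A = (THE B.
     (\<forall>i j. \<not> (i < n \<and> j < n) \<longrightarrow> B i j = 0) \<and>
     (\<forall>i<n. \<forall>j<n. mat_mult {..<n} A B i j = mat_id {..<n} i j \<and>
                   mat_mult {..<n} B A i j = mat_id {..<n} i j))"

definition has_gradient :: "nat \<Rightarrow> (rvec \<Rightarrow> real) \<Rightarrow> rvec \<Rightarrow> rvec \<Rightarrow> bool" where
  "has_gradient n f g x \<longleftrightarrow> g \<in> Rn n \<and>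
     (\<forall>\<epsilon>>0. \<exists>\<eta>>0. \<forall>y\<in>Rn n. vnorm n (y - x) < \<eta> \<longrightarrow>
        \<bar>f y - f x - inner_on {..<n} g (y - x)\<bar> \<le> \<epsilon> * vnorm n (y - x))"

definition continuously_differentiable :: "nat \<Rightarrow> (rvec \<Rightarrow> real) \<Rightarrow> bool" where
  "continuously_differentiable n f \<longleftrightarrow>
     (\<exists>grad. (\<forall>x\<in>Rn n. has_gradient n f (grad x) x) \<and>
             continuous_map (Euclidean_space n) (Euclidean_space n) grad)"

definition proper_fun :: "nat \<Rightarrow> (rvec \<Rightarrow> ereal) \<Rightarrow> bool" where
  "proper_fun n \<phi> \<longleftrightarrow> (\<forall>x\<in>Rn n. \<phi> x \<noteq> -\<infinity>) \<and> (\<exists>x\<in>Rn n. \<phi> x \<noteq> \<infinity>)"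

definition convex_fun :: "nat \<Rightarrow> (rvec \<Rightarrow> ereal) \<Rightarrow> bool" where
  "convex_fun n \<phi> \<longleftrightarrow>
     (\<forall>x\<in>Rn n. \<forall>y\<in>Rn n. \<forall>t. 0 \<le> t \<and> t \<le> 1 \<longrightarrow>
        \<phi> (vscale (1 - t) x + vscale t y) \<le> ereal (1 - t) * \<phi> x + ereal t * \<phi> y)"

definition lsc_fun :: "nat \<Rightarrow> (rvec \<Rightarrow> ereal) \<Rightarrow> bool" where
  "lsc_fun n \<phi> \<longleftrightarrow> (\<forall>a. openin (Euclidean_space n) {x \<in> Rn n. a < \<phi> x})"

definition dom_fun :: "nat \<Rightarrow> (rvec \<Rightarrow> ereal) \<Rightarrow> rvec set" where
  "dom_fun n \<phi> = {x \<in> Rn n. \<phi> x < \<infinity>}"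

definition prox :: "nat \<Rightarrow> (rvec \<Rightarrow> ereal) \<Rightarrow> rmat \<Rightarrow> rvec \<Rightarrow> rvec" where
  "prox n \<phi> \<Lambda> x =
     arg_min_on (\<lambda>y. \<phi> y + ereal (1/2 * inner_on {..<n} (x - y) (mat_vec {..<n} \<Lambda> (x - y)))) (Rn n)"

definition nat_res :: "nat \<Rightarrow> (rvec \<Rightarrow> ereal) \<Rightarrow> rmat \<Rightarrow> rvec \<Rightarrow> rvec \<Rightarrow> rvec" where
  "nat_res n \<phi> \<Lambda> v x = x - prox n \<phi> \<Lambda> (x - mat_vec {..<n} (mat_inverse n \<Lambda>) v)"

definition caratheodory :: "nat \<Rightarrow> 'u measure \<Rightarrow> (rvec \<Rightarrow> 'u \<Rightarrow> rvec) \<Rightarrow> bool" where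
  "caratheodory n U V \<longleftrightarrow>
     (\<forall>x\<in>Rn n. \<forall>u\<in>space U. V x u \<in> Rn n) \<and>
     (\<forall>x\<in>Rn n. (\<lambda>u. V x u) \<in> borel_measurable U) \<and>
     (\<forall>u\<in>space U. continuous_map (Euclidean_space n) (Euclidean_space n) (\<lambda>x. V x u))"

text \<open>One realization of the extra-step method.\<close>

definition extra_step ::
  "nat \<Rightarrow> (rvec \<Rightarrow> ereal) \<Rightarrow> (nat \<Rightarrow> real) \<Rightarrow> (nat \<Rightarrow> real) \<Rightarrow> (nat \<Rightarrow> rmat) \<Rightarrow>
   (nat \<Rightarrow> rvec) \<Rightarrow> (nat \<Rightarrow> rvec) \<Rightarrow> (nat \<Rightarrow> rvec) \<Rightarrow> (nat \<Rightarrow> rvec) \<Rightarrow> bool" where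
  "extra_step n \<phi> \<alpha> \<beta> \<Lambda>p x z vp d \<longleftrightarrow>
     x 0 \<in> dom_fun n \<phi> \<and>
     (\<forall>k. z k = x k + vscale (\<beta> k) (d k) \<and>
          x (Suc k) = prox n \<phi> (\<Lambda>p k)
            (x k + vscale (\<alpha> k) (d k) - mat_vec {..<n} (mat_inverse n (\<Lambda>p k)) (vp k)))"

definition lbfgs_update :: "nat set \<Rightarrow> rvec \<times> rvec \<Rightarrow> rmat \<Rightarrow> rmat" where
  "lbfgs_update I = (\<lambda>(u, y) W.
     let \<rho> = 1 / inner_on I y u
     in mat_mult I (mat_mult I (mat_id I - mat_scale \<rho> (outer u y)) W)
                   (mat_id I - mat_scale \<rho> (outer y u))
        + mat_scale \<rho> (outer u u))"

text \<open>
  The most recent pair is the last one. With an empty memory (as in the first iteration) the formula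
  for \<open>\<gamma>\<close> has no meaning, and the usual start matrix, the identity, is used. Nonzero denominators
  are not required: a degenerate pair with \<open>u = 0\<close> (hence \<open>y = 0\<close>) has \<open>\<rho> = 0\<close> by \<open>1 / 0 = 0\<close>, so its
  update does nothing.
\<close>

definition lbfgs_matrix :: "nat set \<Rightarrow> (rvec \<times> rvec) list \<Rightarrow> rmat" where
  "lbfgs_matrix I ps =
     (let \<gamma> = (if ps = [] then 1
               else (let (u, y) = last ps in inner_on I u y / inner_on I y y))
      in fold (lbfgs_update I) ps (mat_scale \<gamma> (mat_id I)))"

definition stored_pairs :: "nat \<Rightarrow> real \<Rightarrow> (nat \<Rightarrow> rvec \<times> rvec) \<Rightarrow> nat \<Rightarrow> (rvec \<times> rvec) list" where
  "stored_pairs n \<delta> P k =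
     filter (\<lambda>(u, y). inner_on {..<n} u y \<ge> \<delta> * (vnorm n u)\<^sup>2) (map P [0..<k])"

text \<open>The pair of iteration \<open>k\<close> depends on \<open>d k\<close>, so iteration \<open>k\<close> can only use pairs of iterations \<open>j < k\<close>.\<close>

definition used_pairs ::
  "nat \<Rightarrow> nat \<Rightarrow> real \<Rightarrow> (nat \<Rightarrow> rvec \<times> rvec) \<Rightarrow> nat \<Rightarrow> (rvec \<times> rvec) list" where
  "used_pairs n p \<delta> P k =
     (let s = stored_pairs n \<delta> P k in drop (length s - p) s)"

text \<open>The argument \<open>r\<close> is the residual of the current iterate, and \<open>ps\<close> lists the used pairs.\<close>

definition coord_lbfgs_matrix ::
  "nat \<Rightarrow> real \<Rightarrow> real \<Rightarrow> real \<Rightarrow> rvec \<Rightarrow> (rvec \<times> rvec) list \<Rightarrow> rmat" where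
  "coord_lbfgs_matrix n \<delta>1 \<delta>2 \<zeta> r ps =
     (let I = {i. i < n \<and> \<bar>r i\<bar> \<ge> \<delta>2};
          A = {..<n} - I;
          Q = filter (\<lambda>(u, y). \<bar>inner_on I (subvec I u) (subvec I y)\<bar> \<ge> \<delta>1 * (vnorm n u)\<^sup>2) ps
      in if Q \<noteq> []
         then (\<lambda>i j. if i \<in> I \<and> j \<in> I
                      then lbfgs_matrix I (map (\<lambda>(u, y). (subvec I u, subvec I y)) Q) i j
                      else \<zeta> * mat_id A i j)
         else lbfgs_matrix {..<n} ps)"

definition curvature_pair ::
  "nat \<Rightarrow> (rvec \<Rightarrow> ereal) \<Rightarrow> rmat \<Rightarrow> rvec \<Rightarrow> rvec \<Rightarrow> rvec \<Rightarrow> rvec \<Rightarrow> rvec \<times> rvec" where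
  "curvature_pair n \<phi> \<Lambda> x v z vz = (z - x, nat_res n \<phi> \<Lambda> vz z - nat_res n \<phi> \<Lambda> v x)"

text \<open>
  One realization of the coordinate L-BFGS scheme. If no used pair passes the test with \<open>\<delta>1\<close>, then
  the used pairs are only known to satisfy the storage test with \<open>\<delta>\<close>, and \<open>1 / \<delta>\<close> can be the norm of
  the resulting matrix. A bound that covers both cases depends on \<open>min \<delta> \<delta>1\<close>, which is \<open>\<delta>1\<close> if
  \<open>\<delta>1 \<le> \<delta>\<close>.
\<close>

definition coord_lbfgs_scheme ::
  "nat \<Rightarrow> (rvec \<Rightarrow> ereal) \<Rightarrow> (nat \<Rightarrow> rmat) \<Rightarrow> (rvec \<Rightarrow> 'u \<Rightarrow> rvec) \<Rightarrow>
   nat \<Rightarrow> real \<Rightarrow> real \<Rightarrow> real \<Rightarrow> (nat \<Rightarrow> real) \<Rightarrow>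
   (nat \<Rightarrow> 'u) \<Rightarrow> (nat \<Rightarrow> rvec) \<Rightarrow> (nat \<Rightarrow> rvec) \<Rightarrow> (nat \<Rightarrow> rvec) \<Rightarrow> (nat \<Rightarrow> rvec) \<Rightarrow> (nat \<Rightarrow> rmat) \<Rightarrow> bool" where
  "coord_lbfgs_scheme n \<phi> \<Lambda> V p \<delta> \<delta>1 \<delta>2 \<zeta> \<xi> x v z d W \<longleftrightarrow>
     (\<forall>k. let r = nat_res n \<phi> (\<Lambda> k) (v k) (x k);
              P = (\<lambda>j. curvature_pair n \<phi> (\<Lambda> j) (x j) (v j) (z j) (V (z j) (\<xi> j)))
          in W k = coord_lbfgs_matrix n \<delta>1 \<delta>2 (\<zeta> k) r (used_pairs n p \<delta> P k) \<and>
             d k = - mat_vec {..<n} (W k) r)"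

end

theory Submission
  imports Defs
begin

text \<open>
  The proximity operator of \<open>\<lambda>\<^sub>k\<^sup>-\<^sup>1 I\<close> is nonexpansive, so every curvature pair satisfies
  \<open>\<parallel>y\<parallel> \<le> (2 + l) \<parallel>u\<parallel>\<close>. Together with \<open>\<bar>\<langle>u, y\<rangle>\<bar> \<ge> \<delta> \<parallel>u\<parallel>\<^sup>2\<close>, where \<open>\<delta>\<close> stands for the smaller of the two
  curvature parameters, this gives \<open>\<bar>\<gamma>\<bar> \<le> 1/\<delta>\<close>, \<open>\<parallel>\<rho> u u\<^sup>T\<parallel> \<le> 1/\<delta>\<close> and
  \<open>\<parallel>I - \<rho> u y\<^sup>T\<parallel> \<le> 1 + (2 + l)/\<delta>\<close>. Hence an update turns a norm bound \<open>b\<close> into \<open>C b + 1/\<delta>\<close> with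
  \<open>C = (1 + (2 + l)/\<delta>)\<^sup>2 \<ge> 1\<close>, and after at most \<open>p\<close> updates the norm is at most \<open>C\<^sup>p (1 + 1/\<delta> + p/\<delta>)\<close>.
\<close>

section \<open>Vectors and operator bounds\<close>

lemma Rn_iff: "x \<in> Rn n \<longleftrightarrow> (\<forall>i\<ge>n. x i = 0)"
  by (simp add: topspace_Euclidean_space)

lemma L2_set_eq_on:
  assumes "\<And>i. i \<in> I \<Longrightarrow> x i = y i"
  shows "L2_set x I = L2_set y I"
  using assms by (intro L2_set_cong) auto

lemma L2_set_vscale: "L2_set (vscale c x) I = \<bar>c\<bar> * L2_set x I"
  by (simp add: L2_set_def vscale_def power_mult_distrib sum_distrib_left[symmetric] real_sqrt_mult)

lemma L2_set_uminus: "L2_set (- x) I = L2_set x I"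
  by (simp add: L2_set_def)

lemma L2_set_add_le: "L2_set (x + y) I \<le> L2_set x I + L2_set y I"
  using L2_set_triangle_ineq[of x y I] by (simp add: plus_fun_def)

lemma L2_set_diff_le: "L2_set (x - y) I \<le> L2_set x I + L2_set y I"
  using L2_set_add_le[of x "- y" I] by (simp add: L2_set_uminus)

lemma L2_set_square: "(L2_set x I)\<^sup>2 = inner_on I x x"
  by (simp add: L2_set_def inner_on_def sum_nonneg power2_eq_square)

lemma inner_on_self_nonneg: "0 \<le> inner_on I x x"
  by (metis L2_set_square zero_le_power2)

lemma inner_on_commute: "inner_on I x y = inner_on I y x"
  by (simp add: inner_on_def mult.commute)

lemma abs_inner_on_le: "\<bar>inner_on I x y\<bar> \<le> L2_set x I * L2_set y I"
proof -
  have "\<bar>inner_on I x y\<bar> \<le> (\<Sum>i\<in>I. \<bar>x i\<bar> * \<bar>y i\<bar>)"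
    unfolding inner_on_def by (metis (no_types, lifting) abs_mult sum.cong sum_abs)
  then show ?thesis using L2_set_mult_ineq[of x y I] by linarith
qed

lemma L2_set_subvec: "L2_set (subvec I x) I = L2_set x I"
  by (rule L2_set_eq_on) (simp add: subvec_def)

lemma L2_set_mono_set:
  assumes "finite J" "I \<subseteq> J"
  shows "L2_set x I \<le> L2_set x J"
  unfolding L2_set_def using assms by (auto intro!: real_sqrt_le_mono sum_mono2)

section \<open>Matrix operations as operations on linear maps\<close>

lemma mat_vec_add: "mat_vec I (A + B) x = mat_vec I A x + mat_vec I B x"
  by (auto simp: mat_vec_def sum.distrib distrib_right)

lemma mat_vec_scale: "mat_vec I (mat_scale c A) x = vscale c (mat_vec I A x)"
  by (auto simp: mat_vec_def mat_scale_def vscale_def sum_distrib_left mult.assoc)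

lemma mat_vec_id:
  assumes "finite I"
  shows "mat_vec I (mat_id I) x = subvec I x"
proof
  fix i
  have "(\<Sum>j\<in>I. (if i = j \<and> i \<in> I then 1 else 0) * x j) = (\<Sum>j\<in>I. if j = i then x j else 0)"
    by (rule sum.cong) auto
  then show "mat_vec I (mat_id I) x i = subvec I x i"
    using assms by (simp add: mat_vec_def mat_id_def subvec_def)
qed

lemma mat_vec_outer: "mat_vec I (outer x y) z = vscale (inner_on I y z) x"
  by (simp add: mat_vec_def outer_def vscale_def inner_on_def sum_distrib_left mult_ac)

lemma mat_vec_mult: "mat_vec I (mat_mult I A B) x = mat_vec I A (mat_vec I B x)"
proof
  fix i
  have "mat_vec I (mat_mult I A B) x i = (\<Sum>j\<in>I. \<Sum>k\<in>I. A i k * B k j * x j)"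
    by (simp add: mat_vec_def mat_mult_def sum_distrib_right)
  also have "\<dots> = (\<Sum>k\<in>I. \<Sum>j\<in>I. A i k * B k j * x j)"
    by (rule sum.swap)
  also have "\<dots> = mat_vec I A (mat_vec I B x) i"
    by (simp add: mat_vec_def sum_distrib_left mult.assoc)
  finally show "mat_vec I (mat_mult I A B) x i = mat_vec I A (mat_vec I B x) i" .
qed

text \<open>A norm bound kept as an inequality instead of a supremum, so that it composes under sums
  and products. \<open>mat_vec I\<close> reads a vector only on \<open>I\<close>, hence
  \<open>x\<close> ranges over all functions. The clause \<open>0 \<le> b\<close> keeps products of
  bounds monotone even if \<open>I\<close> is empty.\<close>

definition op_bounded :: "nat set \<Rightarrow> rmat \<Rightarrow> real \<Rightarrow> bool" where
  "op_bounded I A b \<longleftrightarrow> 0 \<le> b \<and> (\<forall>x. L2_set (mat_vec I A x) I \<le> b * L2_set x I)"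

lemma op_bounded_mono: "op_bounded I A b \<Longrightarrow> b \<le> c \<Longrightarrow> op_bounded I A c"
  unfolding op_bounded_def by (meson L2_set_nonneg mult_right_mono order_trans)

lemma op_bounded_id: "finite I \<Longrightarrow> op_bounded I (mat_id I) 1"
  by (simp add: op_bounded_def mat_vec_id L2_set_subvec)

lemma op_bounded_scale: "op_bounded I A b \<Longrightarrow> op_bounded I (mat_scale c A) (\<bar>c\<bar> * b)"
  by (simp add: op_bounded_def mat_vec_scale L2_set_vscale mult.assoc mult_left_mono)

lemma op_bounded_add:
  assumes "op_bounded I A a" "op_bounded I B b"
  shows "op_bounded I (A + B) (a + b)"
  unfolding op_bounded_def mat_vec_add
proof (intro conjI allI)
  show "0 \<le> a + b" using assms by (simp add: op_bounded_def)
  fix x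
  have "L2_set (mat_vec I A x + mat_vec I B x) I
      \<le> L2_set (mat_vec I A x) I + L2_set (mat_vec I B x) I"
    by (rule L2_set_add_le)
  also have "\<dots> \<le> a * L2_set x I + b * L2_set x I"
    using assms by (intro add_mono) (auto simp: op_bounded_def)
  finally show "L2_set (mat_vec I A x + mat_vec I B x) I \<le> (a + b) * L2_set x I"
    by (simp add: distrib_right)
qed

lemma op_bounded_diff:
  assumes "op_bounded I A a" "op_bounded I B b"
  shows "op_bounded I (A - B) (a + b)"
proof -
  have "A - B = A + mat_scale (-1) B"
    by (intro ext) (simp add: mat_scale_def)
  then show ?thesis
    using op_bounded_add[OF assms(1) op_bounded_scale[OF assms(2), of "-1"]] by (simp only:) simp
qed

lemma op_bounded_outer: "op_bounded I (outer x y) (L2_set x I * L2_set y I)"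
  unfolding op_bounded_def
proof (intro conjI allI)
  show "0 \<le> L2_set x I * L2_set y I" by (simp add: L2_set_nonneg)
  fix z
  have "\<bar>inner_on I y z\<bar> * L2_set x I \<le> (L2_set y I * L2_set z I) * L2_set x I"
    by (intro mult_right_mono abs_inner_on_le L2_set_nonneg)
  then show "L2_set (mat_vec I (outer x y) z) I \<le> L2_set x I * L2_set y I * L2_set z I"
    by (simp add: mat_vec_outer L2_set_vscale mult_ac)
qed

lemma op_bounded_mult:
  assumes "op_bounded I A a" "op_bounded I B b"
  shows "op_bounded I (mat_mult I A B) (a * b)"
  unfolding op_bounded_def mat_vec_mult
proof (intro conjI allI)
  show "0 \<le> a * b" using assms by (simp add: op_bounded_def)
  fix x
  have "L2_set (mat_vec I A (mat_vec I B x)) I \<le> a * L2_set (mat_vec I B x) I"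
    using assms by (simp add: op_bounded_def)
  also have "\<dots> \<le> a * (b * L2_set x I)"
    using assms by (intro mult_left_mono) (auto simp: op_bounded_def)
  finally show "L2_set (mat_vec I A (mat_vec I B x)) I \<le> a * b * L2_set x I"
    by (simp add: mult.assoc)
qed

text \<open>The zero vector makes the set under \<open>Sup\<close> nonempty, and \<open>b\<close>
  bounds each of its elements.\<close>

lemma spectral_norm_le:
  assumes "op_bounded {..<n} A b"
  shows "spectral_norm n A \<le> b"
  unfolding spectral_norm_def
proof (rule cSup_least)
  have "(0 :: rvec) \<in> Rn n \<and> vnorm n 0 \<le> 1"
    by (simp add: Rn_iff L2_set_def)
  then show "{vnorm n (mat_vec {..<n} A x) |x. x \<in> Rn n \<and> vnorm n x \<le> 1} \<noteq> {}"
    by blast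
next
  fix r assume "r \<in> {vnorm n (mat_vec {..<n} A x) |x. x \<in> Rn n \<and> vnorm n x \<le> 1}"
  then obtain x where x: "r = vnorm n (mat_vec {..<n} A x)" "vnorm n x \<le> 1" by blast
  have "r \<le> b * vnorm n x" using assms x by (simp add: op_bounded_def)
  also have "\<dots> \<le> b * 1" using assms x by (intro mult_left_mono) (auto simp: op_bounded_def)
  finally show "r \<le> b" by simp
qed

section \<open>Bounds for L-BFGS matrices\<close>

text \<open>
  The scale \<open>s\<close> stands for the norm of the full vector \<open>u\<close>, of which the pair may be a
  restriction to the coordinates \<open>I\<close>.
\<close>

definition good_pair :: "nat set \<Rightarrow> real \<Rightarrow> real \<Rightarrow> rvec \<times> rvec \<Rightarrow> bool" where
  "good_pair I \<kappa> \<delta> = (\<lambda>(u, y). \<exists>s\<ge>0. L2_set u I \<le> s \<and> L2_set y I \<le> \<kappa> * s \<and>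
     \<delta> * s\<^sup>2 \<le> \<bar>inner_on I u y\<bar>)"

text \<open>The single estimate \<open>\<bar>\<rho>\<bar> * s\<^sup>2 \<le> 1 / \<delta>\<close>
  controls all rank-one terms: each outer factor contributes \<open>1 + \<kappa> / \<delta>\<close>,
  the added term \<open>1 / \<delta>\<close>. Only the absolute value of the inner product enters,
  which is what the test with \<open>\<delta>1\<close> controls.\<close>

lemma op_bounded_lbfgs_update:
  assumes I: "finite I" and \<delta>: "\<delta> > 0" and \<kappa>: "\<kappa> \<ge> 0"
    and good: "good_pair I \<kappa> \<delta> (u, y)" and W: "op_bounded I W b"
  shows "op_bounded I (lbfgs_update I (u, y) W) ((1 + \<kappa> / \<delta>)\<^sup>2 * b + 1 / \<delta>)"
proof -
  obtain s where s: "s \<ge> 0" "L2_set u I \<le> s" "L2_set y I \<le> \<kappa> * s"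
      "\<delta> * s\<^sup>2 \<le> \<bar>inner_on I u y\<bar>"
    using good by (auto simp: good_pair_def)
  define \<rho> where "\<rho> = 1 / inner_on I y u"
  have \<rho>: "\<bar>\<rho>\<bar> * s\<^sup>2 \<le> 1 / \<delta>"
  proof (cases "inner_on I y u = 0")
    \<comment> \<open>Division by zero gives \<open>\<rho> = 0\<close>.\<close>
    case True
    then show ?thesis using \<delta> by (simp add: \<rho>_def)
  next
    case False
    then show ?thesis using \<delta> s(4)
      by (simp add: \<rho>_def inner_on_commute[of I u] abs_divide divide_simps mult.commute)
  qed
  have uy: "\<bar>\<rho>\<bar> * (L2_set u I * L2_set y I) \<le> \<kappa> / \<delta>"
  proof -
    have "L2_set u I * L2_set y I \<le> s * (\<kappa> * s)"
      using s \<kappa> by (intro mult_mono) (auto simp: L2_set_nonneg)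
    then have "\<bar>\<rho>\<bar> * (L2_set u I * L2_set y I) \<le> \<bar>\<rho>\<bar> * (s * (\<kappa> * s))"
      by (rule mult_left_mono) simp
    also have "\<dots> = \<kappa> * (\<bar>\<rho>\<bar> * s\<^sup>2)" by (simp add: power2_eq_square)
    also have "\<dots> \<le> \<kappa> * (1 / \<delta>)" using \<rho> \<kappa> by (rule mult_left_mono)
    finally show ?thesis by simp
  qed
  have uu: "\<bar>\<rho>\<bar> * (L2_set u I * L2_set u I) \<le> 1 / \<delta>"
  proof -
    have "L2_set u I * L2_set u I \<le> s * s"
      using s by (intro mult_mono) (auto simp: L2_set_nonneg)
    then have "\<bar>\<rho>\<bar> * (L2_set u I * L2_set u I) \<le> \<bar>\<rho>\<bar> * (s * s)"
      by (rule mult_left_mono) simp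
    then show ?thesis using \<rho> by (simp add: power2_eq_square)
  qed
  have l: "op_bounded I (mat_id I - mat_scale \<rho> (outer u y)) (1 + \<kappa> / \<delta>)"
    by (rule op_bounded_mono[OF op_bounded_diff[OF op_bounded_id[OF I]
          op_bounded_scale[OF op_bounded_outer]]]) (use uy in simp)
  have r: "op_bounded I (mat_id I - mat_scale \<rho> (outer y u)) (1 + \<kappa> / \<delta>)"
    by (rule op_bounded_mono[OF op_bounded_diff[OF op_bounded_id[OF I]
          op_bounded_scale[OF op_bounded_outer]]]) (use uy in \<open>simp add: mult_ac\<close>)
  have e: "op_bounded I (mat_scale \<rho> (outer u u)) (1 / \<delta>)"
    by (rule op_bounded_mono[OF op_bounded_scale[OF op_bounded_outer]]) (use uu in simp)
  have "lbfgs_update I (u, y) W =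
      mat_mult I (mat_mult I (mat_id I - mat_scale \<rho> (outer u y)) W)
        (mat_id I - mat_scale \<rho> (outer y u)) + mat_scale \<rho> (outer u u)"
    by (simp add: lbfgs_update_def \<rho>_def Let_def)
  then show ?thesis
    using op_bounded_add[OF op_bounded_mult[OF op_bounded_mult[OF l W] r] e]
    by (simp add: power2_eq_square mult_ac)
qed

text \<open>Since \<open>(1 + \<kappa> / \<delta>)\<^sup>2 \<ge> 1\<close>, the increment
  \<open>1 / \<delta>\<close> of every step can be charged with the full power of this factor. This
  gives a closed form in place of a geometric sum.\<close>

lemma op_bounded_fold_lbfgs_update:
  assumes I: "finite I" and \<delta>: "\<delta> > 0" and \<kappa>: "\<kappa> \<ge> 0"
  shows "\<forall>q\<in>set ps. good_pair I \<kappa> \<delta> q \<Longrightarrow> op_bounded I W b \<Longrightarrow>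
    op_bounded I (fold (lbfgs_update I) ps W)
      (((1 + \<kappa> / \<delta>)\<^sup>2) ^ length ps * (b + real (length ps) * (1 / \<delta>)))"
proof (induction ps arbitrary: W b)
  case Nil
  then show ?case by simp
next
  case (Cons q ps)
  define C where "C = (1 + \<kappa> / \<delta>)\<^sup>2"
  define e where "e = 1 / \<delta>"
  obtain u y where q: "q = (u, y)" by force
  have C: "1 \<le> C" using \<delta> \<kappa> by (auto simp: C_def)
  have e: "0 \<le> e" using \<delta> by (simp add: e_def)
  have step: "op_bounded I (lbfgs_update I q W) (C * b + e)"
    using op_bounded_lbfgs_update[OF I \<delta> \<kappa>, of u y W b] Cons.prems q by (simp add: C_def e_def)
  have "op_bounded I (fold (lbfgs_update I) ps (lbfgs_update I q W))
      (C ^ length ps * (C * b + e + real (length ps) * e))"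
    using Cons.IH[OF _ step] Cons.prems by (simp add: C_def e_def)
  moreover have "C ^ length ps * (C * b + e + real (length ps) * e)
      \<le> C ^ length ps * (C * (b + (1 + real (length ps)) * e))"
  proof (rule mult_left_mono)
    have "1 * ((1 + real (length ps)) * e) \<le> C * ((1 + real (length ps)) * e)"
      using C e by (intro mult_right_mono) auto
    then show "C * b + e + real (length ps) * e \<le> C * (b + (1 + real (length ps)) * e)"
      by (simp add: algebra_simps)
  qed (use C in simp)
  ultimately show ?case
    by (auto intro: op_bounded_mono simp: C_def[symmetric] e_def[symmetric] mult_ac)
qed

text \<open>The start bound \<open>1 + 1 / \<delta>\<close> covers both the identity used for an
  empty memory and the quotient \<open>\<gamma>\<close>. The bound after all updates grows with
  their number, so \<open>length ps\<close> may be replaced by \<open>p\<close>.\<close>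

lemma op_bounded_lbfgs_matrix:
  assumes I: "finite I" and \<delta>: "\<delta> > 0" and \<kappa>: "\<kappa> \<ge> 0"
    and good: "\<forall>q\<in>set ps. good_pair I \<kappa> \<delta> q" and len: "length ps \<le> p"
  shows "op_bounded I (lbfgs_matrix I ps)
    (((1 + \<kappa> / \<delta>)\<^sup>2) ^ p * (1 + 1 / \<delta> + real p * (1 / \<delta>)))"
proof -
  define \<gamma> where "\<gamma> = (if ps = [] then 1
    else (let (u, y) = last ps in inner_on I u y / inner_on I y y))"
  have \<gamma>: "\<bar>\<gamma>\<bar> \<le> 1 + 1 / \<delta>"
  proof (cases "ps = []")
    case True
    then show ?thesis using \<delta> by (simp add: \<gamma>_def)
  next
    case False
    obtain u y where uy: "last ps = (u, y)" by force
    have "good_pair I \<kappa> \<delta> (u, y)" using good False uy last_in_set[of ps] by fastforce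
    then obtain s where s: "s \<ge> 0" "L2_set u I \<le> s" "\<delta> * s\<^sup>2 \<le> \<bar>inner_on I u y\<bar>"
      by (auto simp: good_pair_def)
    have cs: "\<bar>inner_on I u y\<bar> \<le> s * L2_set y I"
      using abs_inner_on_le[of I u y] s(2) by (meson L2_set_nonneg mult_right_mono order_trans)
    \<comment> \<open>Curvature and Cauchy-Schwarz give
      \<open>\<delta> * s\<^sup>2 \<le> s * L2_set y I\<close>. Cancelling \<open>s\<close> and
      multiplying by the norm of \<open>y\<close> bounds \<open>\<delta> * s * L2_set y I\<close>,
      which dominates the left side.\<close>
    have "\<delta> * \<bar>inner_on I u y\<bar> \<le> (L2_set y I)\<^sup>2"
    proof (cases "s = 0")
      case True
      then show ?thesis using cs by simp
    next
      case False
      then have "s > 0" using s(1) by simp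
      moreover have "s * (\<delta> * s) \<le> s * L2_set y I"
        using s(3) cs by (simp add: power2_eq_square mult_ac)
      ultimately have "\<delta> * s \<le> L2_set y I" by simp
      then have "\<delta> * s * L2_set y I \<le> L2_set y I * L2_set y I"
        by (rule mult_right_mono) simp
      moreover have "\<delta> * \<bar>inner_on I u y\<bar> \<le> \<delta> * (s * L2_set y I)"
        using cs \<delta> by simp
      ultimately show ?thesis by (simp add: power2_eq_square mult_ac)
    qed
    \<comment> \<open>If \<open>y\<close> vanishes on \<open>I\<close>, the quotient is 0 by the
      convention on division.\<close>
    then have "\<bar>inner_on I u y / inner_on I y y\<bar> \<le> 1 / \<delta>"
      using \<delta> inner_on_self_nonneg[of I y]
      by (cases "inner_on I y y = 0")
        (auto simp: L2_set_square abs_divide field_simps)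
    then show ?thesis using False uy by (simp add: \<gamma>_def)
  qed
  have "op_bounded I (mat_scale \<gamma> (mat_id I)) (1 + 1 / \<delta>)"
    by (rule op_bounded_mono[OF op_bounded_scale[OF op_bounded_id[OF I]]]) (use \<gamma> in simp)
  then have "op_bounded I (lbfgs_matrix I ps)
      (((1 + \<kappa> / \<delta>)\<^sup>2) ^ length ps * (1 + 1 / \<delta> + real (length ps) * (1 / \<delta>)))"
    using op_bounded_fold_lbfgs_update[OF I \<delta> \<kappa> good]
    by (simp add: lbfgs_matrix_def \<gamma>_def[symmetric])
  moreover have "((1 + \<kappa> / \<delta>)\<^sup>2) ^ length ps * (1 + 1 / \<delta> + real (length ps) * (1 / \<delta>))
      \<le> ((1 + \<kappa> / \<delta>)\<^sup>2) ^ p * (1 + 1 / \<delta> + real p * (1 / \<delta>))"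
    using \<delta> \<kappa> len by (intro mult_mono power_increasing add_mono) (auto intro!: divide_right_mono)
  ultimately show ?thesis by (rule op_bounded_mono)
qed

text \<open>The two blocks act on disjoint sets of coordinates, so the squared norm splits and the
  larger of the two block bounds serves for the whole matrix.\<close>

lemma op_bounded_block_diag:
  assumes I: "I \<subseteq> {..<n}" and A: "op_bounded I A b" and \<zeta>: "\<bar>\<zeta>\<bar> \<le> c"
  shows "op_bounded {..<n}
    (\<lambda>i j. if i \<in> I \<and> j \<in> I then A i j else \<zeta> * mat_id ({..<n} - I) i j) (max b c)"
    (is "op_bounded _ ?W _")
  unfolding op_bounded_def
proof (intro conjI allI)
  have b: "0 \<le> b" using A by (simp add: op_bounded_def)
  then show "0 \<le> max b c" by simp
  fix x
  \<comment> \<open>In a row of \<open>I\<close>, the columns outside \<open>I\<close> hold entries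
    of \<open>mat_id ({..<n} - I)\<close>, which are zero there.\<close>
  have on_I: "mat_vec {..<n} ?W x i = mat_vec I A x i" if "i \<in> I" for i
  proof -
    have "(\<Sum>j<n. ?W i j * x j) = (\<Sum>j\<in>I. ?W i j * x j)"
      using I that by (intro sum.mono_neutral_right) (auto simp: mat_id_def)
    also have "\<dots> = (\<Sum>j\<in>I. A i j * x j)" using that by (intro sum.cong) auto
    finally show ?thesis by (simp add: mat_vec_def)
  qed
  have off_I: "mat_vec {..<n} ?W x i = \<zeta> * x i" if "i \<in> {..<n} - I" for i
  proof -
    have "(\<Sum>j<n. ?W i j * x j) = (\<Sum>j\<in>{i}. ?W i j * x j)"
      using that by (intro sum.mono_neutral_right) (auto simp: mat_id_def)
    then show ?thesis using that by (simp add: mat_vec_def mat_id_def)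
  qed
  have split: "(vnorm n v)\<^sup>2 = (L2_set v I)\<^sup>2 + (L2_set v ({..<n} - I))\<^sup>2" for v
    using I sum.subset_diff[of I "{..<n}" "\<lambda>i. v i * v i"]
    by (simp add: L2_set_square inner_on_def)
  have p1: "L2_set (mat_vec {..<n} ?W x) I \<le> max b c * L2_set x I"
  proof -
    have "L2_set (mat_vec {..<n} ?W x) I = L2_set (mat_vec I A x) I"
      by (rule L2_set_eq_on) (rule on_I)
    also have "\<dots> \<le> b * L2_set x I" using A by (simp add: op_bounded_def)
    also have "\<dots> \<le> max b c * L2_set x I" by (rule mult_right_mono) auto
    finally show ?thesis .
  qed
  have p2: "L2_set (mat_vec {..<n} ?W x) ({..<n} - I) \<le> max b c * L2_set x ({..<n} - I)"
  proof -
    have "L2_set (mat_vec {..<n} ?W x) ({..<n} - I) = L2_set (vscale \<zeta> x) ({..<n} - I)"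
      by (rule L2_set_eq_on) (simp only: off_I vscale_def)
    also have "\<dots> = \<bar>\<zeta>\<bar> * L2_set x ({..<n} - I)" by (rule L2_set_vscale)
    also have "\<dots> \<le> max b c * L2_set x ({..<n} - I)"
      using \<zeta> by (intro mult_right_mono) auto
    finally show ?thesis .
  qed
  have "(vnorm n (mat_vec {..<n} ?W x))\<^sup>2
      \<le> (max b c * L2_set x I)\<^sup>2 + (max b c * L2_set x ({..<n} - I))\<^sup>2"
    unfolding split[of "mat_vec {..<n} ?W x"]
    by (intro add_mono power_mono p1 p2 L2_set_nonneg)
  also have "\<dots> = (max b c * vnorm n x)\<^sup>2"
    by (simp add: power_mult_distrib split[of x] distrib_left)
  finally show "vnorm n (mat_vec {..<n} ?W x) \<le> max b c * vnorm n x"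
    by (rule power2_le_imp_le) (use b in \<open>simp add: L2_set_nonneg max.coboundedI1\<close>)
qed

text \<open>The constant of the theorem. The first entry of the maximum is the L-BFGS bound with
  \<open>\<kappa> = 2 + l\<close>; the second covers the block that is a multiple of the identity.
  The dimension does not occur.\<close>

definition coord_bound :: "real \<Rightarrow> nat \<Rightarrow> real \<Rightarrow> real \<Rightarrow> real" where
  "coord_bound l p \<delta> c = max (((1 + (2 + l) / \<delta>)\<^sup>2) ^ p * (1 + 1 / \<delta> + real p * (1 / \<delta>))) c"

text \<open>The test with \<open>\<delta>1\<close> compares with the norm of the full vector
  \<open>u\<close>, so this norm is the scale \<open>s\<close> of the restricted pair, and
  restriction only shrinks norms. If no pair passes, the storage test supplies the curvature on all
  coordinates. The minimum of the two parameters makes one constant serve both cases.\<close>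

lemma op_bounded_coord_lbfgs_matrix:
  assumes pos: "\<delta> > 0" "\<delta>1 > 0" "l > 0" and \<zeta>: "\<bar>\<zeta>\<bar> \<le> c" and len: "length ps \<le> p"
    and lip: "\<And>u y. (u, y) \<in> set ps \<Longrightarrow> vnorm n y \<le> (2 + l) * vnorm n u"
    and curv: "\<And>u y. (u, y) \<in> set ps \<Longrightarrow> \<delta> * (vnorm n u)\<^sup>2 \<le> inner_on {..<n} u y"
  shows "op_bounded {..<n} (coord_lbfgs_matrix n \<delta>1 \<delta>2 \<zeta> r ps) (coord_bound l p (min \<delta> \<delta>1) c)"
proof -
  define I where "I = {i. i < n \<and> \<bar>r i\<bar> \<ge> \<delta>2}"
  define Q where
    "Q = filter (\<lambda>(u, y). \<bar>inner_on I (subvec I u) (subvec I y)\<bar> \<ge> \<delta>1 * (vnorm n u)\<^sup>2) ps"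
  define \<delta>' where "\<delta>' = min \<delta> \<delta>1"
  have \<delta>': "\<delta>' > 0" "\<delta>' \<le> \<delta>" "\<delta>' \<le> \<delta>1" using pos by (auto simp: \<delta>'_def)
  have I: "I \<subseteq> {..<n}" by (auto simp: I_def)
  then have fin: "finite I" using finite_subset by blast
  have eq: "coord_lbfgs_matrix n \<delta>1 \<delta>2 \<zeta> r ps = (if Q \<noteq> []
      then (\<lambda>i j. if i \<in> I \<and> j \<in> I
        then lbfgs_matrix I (map (\<lambda>(u, y). (subvec I u, subvec I y)) Q) i j
        else \<zeta> * mat_id ({..<n} - I) i j)
      else lbfgs_matrix {..<n} ps)"
    by (simp only: coord_lbfgs_matrix_def Let_def I_def Q_def)
  let ?b = "((1 + (2 + l) / \<delta>')\<^sup>2) ^ p * (1 + 1 / \<delta>' + real p * (1 / \<delta>'))"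
  show ?thesis
  proof (cases "Q = []")
    case False
    let ?B = "lbfgs_matrix I (map (\<lambda>(u, y). (subvec I u, subvec I y)) Q)"
    have "good_pair I (2 + l) \<delta>' (subvec I u, subvec I y)" if "(u, y) \<in> set Q" for u y
    proof -
      have ps: "(u, y) \<in> set ps" and Q: "\<delta>1 * (vnorm n u)\<^sup>2 \<le> \<bar>inner_on I (subvec I u) (subvec I y)\<bar>"
        using that by (auto simp: Q_def)
      have "\<delta>' * (vnorm n u)\<^sup>2 \<le> \<delta>1 * (vnorm n u)\<^sup>2" using \<delta>' by (intro mult_right_mono) auto
      moreover have "L2_set u I \<le> vnorm n u" "L2_set y I \<le> vnorm n y"
        using I by (auto intro: L2_set_mono_set)
      ultimately show ?thesis
        unfolding good_pair_def using Q lip[OF ps]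
        by (auto intro!: exI[of _ "vnorm n u"] simp: L2_set_subvec)
    qed
    moreover have "length Q \<le> p" using len by (auto simp: Q_def intro: order_trans[OF length_filter_le])
    ultimately have "op_bounded I ?B ?b"
      using \<delta>' pos by (intro op_bounded_lbfgs_matrix fin) auto
    from op_bounded_block_diag[OF I this \<zeta>] show ?thesis
      using False by (simp only: eq coord_bound_def \<delta>'_def if_True not_False_eq_True)
  next
    case True
    have "good_pair {..<n} (2 + l) \<delta>' (u, y)" if ps: "(u, y) \<in> set ps" for u y
    proof -
      have "\<delta>' * (vnorm n u)\<^sup>2 \<le> \<delta> * (vnorm n u)\<^sup>2" using \<delta>' by (intro mult_right_mono) auto
      then show ?thesis
        unfolding good_pair_def using lip[OF ps] curv[OF ps]
        by (auto intro!: exI[of _ "vnorm n u"])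
    qed
    then have "op_bounded {..<n} (lbfgs_matrix {..<n} ps) ?b"
      using \<delta>' pos len by (intro op_bounded_lbfgs_matrix) auto
    then show ?thesis
      using True by (auto intro: op_bounded_mono simp: eq coord_bound_def \<delta>'_def)
  qed
qed

section \<open>Vanishing rows outside the coordinates\<close>

lemma lbfgs_update_row_zero:
  assumes "i \<notin> I" "u i = 0"
  shows "lbfgs_update I (u, y) W i j = 0"
  using assms by (simp add: lbfgs_update_def Let_def mat_mult_def mat_id_def mat_scale_def outer_def)

text \<open>The left factor of an update and its added term both have a zero row \<open>i\<close>,
  so every update produces one. For an empty list the row is that of the start matrix.\<close>

lemma lbfgs_matrix_row_zero:
  assumes i: "i \<notin> I" and u: "\<And>u y. (u, y) \<in> set ps \<Longrightarrow> u i = 0"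
  shows "lbfgs_matrix I ps i j = 0"
proof -
  have "\<forall>(u, y)\<in>set ps. u i = 0 \<Longrightarrow> \<forall>j. W i j = 0 \<Longrightarrow> fold (lbfgs_update I) ps W i j = 0" for W
    by (induction ps arbitrary: W) (auto simp: lbfgs_update_row_zero[OF i])
  moreover have "\<forall>j. mat_scale \<gamma> (mat_id I) i j = 0" for \<gamma>
    using i by (simp add: mat_scale_def mat_id_def)
  ultimately show ?thesis using u unfolding lbfgs_matrix_def Let_def by blast
qed

text \<open>Ensures that the matrix maps into \<open>Rn n\<close>, and so keeps the directions in
  the space.\<close>

lemma coord_lbfgs_matrix_row_zero:
  assumes i: "n \<le> i" and u: "\<And>u y. (u, y) \<in> set ps \<Longrightarrow> u \<in> Rn n"
  shows "coord_lbfgs_matrix n \<delta>1 \<delta>2 \<zeta> r ps i j = 0"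
proof -
  have "lbfgs_matrix {..<n} ps i j = 0"
    using i u by (intro lbfgs_matrix_row_zero) (auto simp: Rn_iff)
  then show ?thesis using i by (simp add: coord_lbfgs_matrix_def Let_def mat_id_def)
qed

section \<open>The proximity operator\<close>

lemma Euclidean_space_eq_top_of_set: "Euclidean_space n = top_of_set (Rn n)"
  by (simp add: Euclidean_space_def euclidean_product_topology)

lemma compactin_Euclidean_space_iff: "compactin (Euclidean_space n) K \<longleftrightarrow> compact K \<and> K \<subseteq> Rn n"
  by (subst Euclidean_space_eq_top_of_set) (simp only: compactin_subtopology compactin_euclidean_iff)

lemma openin_Euclidean_space_vimage:
  "continuous_on (Rn n) g \<Longrightarrow> open T \<Longrightarrow> openin (Euclidean_space n) (Rn n \<inter> g -` T)"
  by (subst Euclidean_space_eq_top_of_set) (rule continuous_openin_preimage_gen)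

text \<open>Otherwise the open sets of all \<open>x\<close> with \<open>g y < g x\<close>, for
  \<open>y\<close> in \<open>K\<close>, cover \<open>K\<close>. Take a finite subcover and the index
  \<open>y0\<close> of least value: it lies in one of the sets, so some index has a smaller value
  still. Any linear order is allowed as range, in particular \<open>ereal\<close>.\<close>

lemma lsc_attains_inf:
  fixes g :: "'a \<Rightarrow> 'b :: linorder"
  assumes K: "compactin X K" "K \<noteq> {}"
    and lsc: "\<And>a. openin X {x \<in> topspace X. a < g x}"
  shows "\<exists>x\<in>K. \<forall>y\<in>K. g x \<le> g y"
proof (rule ccontr)
  assume "\<not> ?thesis"
  then have neg: "\<forall>x\<in>K. \<exists>y\<in>K. g y < g x" by (meson not_le)
  let ?U = "\<lambda>y. {x \<in> topspace X. g y < g x}"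
  have sub: "K \<subseteq> topspace X" using K(1) by (rule compactin_subset_topspace)
  have "K \<subseteq> \<Union> (?U ` K)" using neg sub by blast
  moreover have "\<And>S. S \<in> ?U ` K \<Longrightarrow> openin X S" using lsc by blast
  ultimately obtain \<F> where \<F>: "finite \<F>" "\<F> \<subseteq> ?U ` K" "K \<subseteq> \<Union> \<F>"
    using K(1) unfolding compactin_def by meson
  then obtain F where F: "F \<subseteq> K" "finite F" "\<F> = ?U ` F" by (meson finite_subset_image)
  have ne: "F \<noteq> {}" using F(3) \<F>(3) K(2) by auto
  obtain y0 where y0: "y0 \<in> F" "\<forall>y\<in>F. g y0 \<le> g y"
    using finite_has_minimal[of "g ` F"] F(2) ne
    by (metis (no_types, lifting) Min_in Min_le finite_imageI image_iff image_is_empty)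
  then obtain y where "y \<in> F" "g y < g y0" using F \<F>(3) by blast
  then show False using y0 by (meson not_le)
qed

lemma continuous_on_vnorm_diff: "continuous_on S (\<lambda>y. vnorm n (y - x0))"
  unfolding L2_set_def minus_apply
  by (intro continuous_intros continuous_on_subset[OF continuous_on_product_coordinates]) auto

lemma continuous_on_quadratic:
  "continuous_on S (\<lambda>y. inner_on {..<n} (x - y) (mat_vec {..<n} A (x - y)))"
  unfolding inner_on_def mat_vec_def minus_apply
  by (intro continuous_intros continuous_on_subset[OF continuous_on_product_coordinates]) auto

text \<open>The ball is a closed part of the box \<open>B\<close>, a product of intervals in the
  first \<open>n\<close> coordinates and of \<open>{0}\<close> elsewhere, which is compact by
  Tychonoff.\<close>

lemma compactin_closed_ball:
  assumes x0: "x0 \<in> Rn n"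
  shows "compactin (Euclidean_space n) {y \<in> Rn n. vnorm n (y - x0) \<le> R}"
proof -
  define B where "B = PiE UNIV (\<lambda>i. if i < n then {x0 i - R .. x0 i + R} else {0 :: real})"
  have "compactin (powertop_real UNIV) B"
    unfolding B_def by (subst compactin_PiE) auto
  then have B: "compact B" by (simp add: euclidean_product_topology)
  have sub: "B \<subseteq> Rn n"
  proof
    fix y assume y: "y \<in> B"
    have "y i = 0" if "i \<ge> n" for i
      using PiE_mem[OF y[unfolded B_def], of i] that by simp
    then show "y \<in> Rn n" by (simp add: Rn_iff)
  qed
  have "y \<in> B" if y: "y \<in> Rn n" "vnorm n (y - x0) \<le> R" for y
  proof -
    have "\<bar>y i - x0 i\<bar> \<le> R" if "i < n" for i
    proof -
      have "\<bar>(y - x0) i\<bar> \<le> L2_set (\<lambda>i. \<bar>(y - x0) i\<bar>) {..<n}"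
        using that by (intro member_le_L2_set) auto
      also have "\<dots> = vnorm n (y - x0)" by (simp add: L2_set_def)
      finally show ?thesis using y(2) by simp
    qed
    then have "y i \<in> (if i < n then {x0 i - R .. x0 i + R} else {0})" for i
      using y(1) by (fastforce simp: Rn_iff abs_le_iff)
    then show ?thesis unfolding B_def by (intro PiE_I) auto
  qed
  then have eq: "{y \<in> Rn n. vnorm n (y - x0) \<le> R} = B \<inter> {y. vnorm n (y - x0) \<le> R}"
    using sub by blast
  have "closed {y. vnorm n (y - x0) \<le> R}"
    by (intro closed_Collect_le continuous_on_vnorm_diff continuous_on_const)
  then have "compact {y \<in> Rn n. vnorm n (y - x0) \<le> R}"
    unfolding eq using B by (rule compact_Int_closed[rotated])
  then show ?thesis
    by (auto simp: compactin_Euclidean_space_iff)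
qed

text \<open>The quadratic form has a positive minimum on the compact unit sphere, and homogeneity of
  degree two carries the bound to all vectors.\<close>

lemma sym_pos_def_coercive:
  assumes "sym_pos_def n A"
  shows "\<exists>c>0. \<forall>w. c * (vnorm n w)\<^sup>2 \<le> inner_on {..<n} w (mat_vec {..<n} A w)"
proof -
  let ?Q = "\<lambda>w. inner_on {..<n} w (mat_vec {..<n} A w)"
  let ?S = "{y \<in> Rn n. vnorm n y = 1}"
  have contQ: "continuous_on S ?Q" for S
    using continuous_on_quadratic[of S n 0 A]
    by (simp add: inner_on_def mat_vec_def sum_negf)
  have contN: "continuous_on S (\<lambda>y. vnorm n y)" for S
    using continuous_on_vnorm_diff[of S 0 n] by (simp only: diff_zero)
  \<comment> \<open>The claim is about all functions \<open>w\<close>, but the sphere lies in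
    \<open>Rn n\<close>, so entries from \<open>n\<close> on are cut off before scaling.\<close>
  have Q_restrict: "?Q (subvec {..<n} w) = ?Q w" for w
    by (simp add: inner_on_def mat_vec_def subvec_def)
  have Q_scale: "?Q (vscale t w) = t\<^sup>2 * ?Q w" for t w
    by (simp add: inner_on_def mat_vec_def vscale_def sum_distrib_left power2_eq_square mult_ac)
  have "\<exists>c>0. \<forall>w\<in>?S. c \<le> ?Q w"
  proof (cases "?S = {}")
    \<comment> \<open>The sphere is empty for \<open>n = 0\<close>; any positive constant
      serves.\<close>
    case True
    then show ?thesis by (metis empty_iff zero_less_one)
  next
    case False
    have "?S = {y \<in> Rn n. vnorm n (y - 0) \<le> 1} \<inter> {y. vnorm n y = 1}" by auto
    moreover have "compact {y \<in> Rn n. vnorm n (y - 0) \<le> 1}"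
      using compactin_closed_ball[of 0 n 1]
      by (simp add: Rn_iff compactin_Euclidean_space_iff)
    moreover have "closed {y. vnorm n y = 1}"
      by (intro closed_Collect_eq contN continuous_on_const)
    ultimately have "compact ?S" by (metis (no_types, lifting) compact_Int_closed)
    then obtain w where w: "w \<in> ?S" "\<forall>y\<in>?S. ?Q w \<le> ?Q y"
      using continuous_attains_inf[OF _ False contQ] by blast
    have "w \<noteq> 0" using w(1) by (auto simp: L2_set_def)
    then have "?Q w > 0" using assms w(1) by (simp add: sym_pos_def_def)
    then show ?thesis using w(2) by blast
  qed
  then obtain c where c: "c > 0" "\<forall>w\<in>?S. c \<le> ?Q w" by blast
  have "c * (vnorm n w)\<^sup>2 \<le> ?Q w" for w
  proof (cases "vnorm n w = 0")
    case True
    then have "\<forall>i<n. w i = 0" by (simp add: L2_set_eq_0_iff)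
    then show ?thesis using True by (simp add: inner_on_def)
  next
    case False
    define t where "t = vnorm n w"
    have t: "t > 0" using False by (simp add: t_def order_less_le)
    define v where "v = vscale (1 / t) (subvec {..<n} w)"
    have "vnorm n v = 1" using t
      unfolding v_def L2_set_vscale L2_set_subvec t_def[symmetric] by simp
    moreover have "v \<in> Rn n" by (simp add: v_def Rn_iff subvec_def vscale_def)
    ultimately have "v \<in> ?S" by simp
    then have "c \<le> (1 / t)\<^sup>2 * ?Q w" using c(2) by (metis v_def Q_scale Q_restrict)
    then show ?thesis using t by (simp add: t_def[symmetric] field_simps power2_eq_square)
  qed
  then show ?thesis using c(1) by blast
qed

section \<open>Existence of proximal points\<close>

lemma openin_lsc_add_quadratic:
  assumes "lsc_fun n \<phi>" and cont: "\<And>S. continuous_on S q"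
  shows "openin (Euclidean_space n) {y \<in> topspace (Euclidean_space n). a < \<phi> y + ereal (q y)}"
proof -
  \<comment> \<open>A real \<open>b\<close> separates the two summands, so the superlevel set is a
    union over \<open>b\<close> of intersections of two open sets. The witness is
    \<open>d - q y\<close> for a real \<open>d\<close> strictly between \<open>a\<close> and the
    sum.\<close>
  have *: "(a < \<phi> y + ereal (q y)) \<longleftrightarrow> (\<exists>b::real. ereal b < \<phi> y \<and> a < ereal (b + q y))" for y
  proof
    assume "a < \<phi> y + ereal (q y)"
    then obtain d where "a < ereal d" "ereal d < \<phi> y + ereal (q y)" using ereal_dense2 by blast
    then have "ereal (d - q y) < \<phi> y" "a < ereal ((d - q y) + q y)"
      by (cases "\<phi> y"; simp)+
    then show "\<exists>b::real. ereal b < \<phi> y \<and> a < ereal (b + q y)" by blast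
  next
    assume "\<exists>b::real. ereal b < \<phi> y \<and> a < ereal (b + q y)"
    then obtain b where b: "ereal b < \<phi> y" "a < ereal (b + q y)" by blast
    have "ereal (b + q y) \<le> \<phi> y + ereal (q y)" using b(1) by (cases "\<phi> y") auto
    then show "a < \<phi> y + ereal (q y)" using b(2) by (rule less_le_trans[rotated])
  qed
  have "openin (Euclidean_space n) {y \<in> Rn n. ereal b < \<phi> y \<and> a < ereal (b + q y)}" for b
  proof -
    have "openin (Euclidean_space n) (Rn n \<inter> (\<lambda>y. ereal (b + q y)) -` {a<..})"
      by (intro openin_Euclidean_space_vimage continuous_intros cont)
    moreover have "openin (Euclidean_space n) {y \<in> Rn n. ereal b < \<phi> y}"
      using assms(1) by (simp add: lsc_fun_def)
    ultimately have "openin (Euclidean_space n)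
        ({y \<in> Rn n. ereal b < \<phi> y} \<inter> (Rn n \<inter> (\<lambda>y. ereal (b + q y)) -` {a<..}))"
      by (rule openin_Int[rotated])
    moreover have "{y \<in> Rn n. ereal b < \<phi> y} \<inter> (Rn n \<inter> (\<lambda>y. ereal (b + q y)) -` {a<..})
        = {y \<in> Rn n. ereal b < \<phi> y \<and> a < ereal (b + q y)}" by auto
    ultimately show ?thesis by simp
  qed
  then have "openin (Euclidean_space n)
      (\<Union>b. {y \<in> Rn n. ereal b < \<phi> y \<and> a < ereal (b + q y)})" by (intro openin_Union) auto
  moreover have "(\<Union>b. {y \<in> Rn n. ereal b < \<phi> y \<and> a < ereal (b + q y)})
      = {y \<in> Rn n. a < \<phi> y + ereal (q y)}" by (auto simp: *)
  ultimately show ?thesis by simp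
qed

text \<open>
  The minimum of \<open>\<phi>\<close> over the unit ball around \<open>x0\<close>, extended along rays by convexity, gives a lower
  bound of linear growth.
\<close>

lemma convex_lsc_linear_lower_bound:
  assumes cvx: "convex_fun n \<phi>" and lsc: "lsc_fun n \<phi>" and proper: "proper_fun n \<phi>"
    and x0: "x0 \<in> Rn n" "\<phi> x0 = ereal P"
  shows "\<exists>a\<ge>0. \<forall>y\<in>Rn n. ereal (P - a * max 1 (vnorm n (y - x0))) \<le> \<phi> y"
proof -
  let ?K = "{y \<in> Rn n. vnorm n (y - x0) \<le> 1}"
  have x0K: "x0 \<in> ?K" using x0 by (simp add: L2_set_def)
  have "\<exists>x\<in>?K. \<forall>y\<in>?K. \<phi> x \<le> \<phi> y"
    using lsc x0K by (intro lsc_attains_inf[OF compactin_closed_ball[OF x0(1)]])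
      (auto simp: lsc_fun_def)
  then obtain w where w: "w \<in> ?K" "\<And>y. y \<in> ?K \<Longrightarrow> \<phi> w \<le> \<phi> y" by blast
  have "\<phi> w \<le> ereal P" using w(2)[OF x0K] x0 by simp
  moreover have "\<phi> w \<noteq> -\<infinity>" using proper w(1) by (simp add: proper_fun_def)
  ultimately obtain m where m: "\<phi> w = ereal m" "m \<le> P" by (cases "\<phi> w") auto
  \<comment> \<open>The slope is \<open>P - m\<close>: inside the unit ball the bound is then
    exactly the minimum \<open>m\<close>.\<close>
  have "ereal (P - (P - m) * max 1 (vnorm n (y - x0))) \<le> \<phi> y" if y: "y \<in> Rn n" for y
  proof (cases "vnorm n (y - x0) \<le> 1")
    case True
    then show ?thesis using w(2)[of y] y m by simp
  next
    case False
    define t where "t = vnorm n (y - x0)"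
    have t: "t > 1" using False by (simp add: t_def)
    show ?thesis
    proof (cases "\<phi> y")
      case (real r)
      \<comment> \<open>The point where the segment from \<open>x0\<close> to \<open>y\<close> meets
        the unit sphere around \<open>x0\<close>. Its value is at least \<open>m\<close>, and
        convexity turns this into a lower bound for \<open>\<phi> y\<close>.\<close>
      let ?v = "vscale (1 - 1 / t) x0 + vscale (1 / t) y"
      have "?v - x0 = vscale (1 / t) (y - x0)"
        by (intro ext) (simp add: vscale_def algebra_simps)
      then have "vnorm n (?v - x0) = 1" using t by (simp add: L2_set_vscale t_def[symmetric])
      moreover have "?v \<in> Rn n" using x0 y by (simp add: Rn_iff vscale_def)
      ultimately have "ereal m \<le> \<phi> ?v" using w(2)[of ?v] m by simp
      also have "\<phi> ?v \<le> ereal (1 - 1 / t) * \<phi> x0 + ereal (1 / t) * \<phi> y"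
        using cvx x0 y t unfolding convex_fun_def by auto
      finally have "m \<le> (1 - 1 / t) * P + 1 / t * r" using x0 real by simp
      then have "t * m \<le> t * ((1 - 1 / t) * P + 1 / t * r)" using t by simp
      also have "\<dots> = (t - 1) * P + r" using t by (simp add: field_simps)
      finally show ?thesis using real t by (simp add: t_def[symmetric] max_def algebra_simps)
    next
      case MInf
      then show ?thesis using proper y by (simp add: proper_fun_def)
    qed simp
  qed
  then show ?thesis using m(2) by (intro exI[of _ "P - m"]) auto
qed

text \<open>The quadratic term outgrows the linear lower bound of \<open>\<phi>\<close>, so outside
  a large ball around a point \<open>x0\<close> of finite value the objective is no smaller than at
  \<open>x0\<close>. A minimum over the ball, which exists by lower semicontinuity and compactness,
  is therefore global.\<close>

lemma prox_minimizes:
  assumes cvx: "convex_fun n \<phi>" and lsc: "lsc_fun n \<phi>" and proper: "proper_fun n \<phi>"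
    and A: "sym_pos_def n A"
  defines "h \<equiv> \<lambda>x y. \<phi> y + ereal (1/2 * inner_on {..<n} (x - y) (mat_vec {..<n} A (x - y)))"
  shows "prox n \<phi> A x \<in> Rn n" and "y \<in> Rn n \<Longrightarrow> h x (prox n \<phi> A x) \<le> h x y"
proof -
  let ?Q = "\<lambda>y. inner_on {..<n} (x - y) (mat_vec {..<n} A (x - y))"
  obtain c where c: "c > 0" "\<And>w. c * (vnorm n w)\<^sup>2 \<le> inner_on {..<n} w (mat_vec {..<n} A w)"
    using sym_pos_def_coercive[OF A] by blast
  obtain x0 where x0: "x0 \<in> Rn n" "\<phi> x0 \<noteq> \<infinity>" using proper by (auto simp: proper_fun_def)
  moreover have "\<phi> x0 \<noteq> -\<infinity>" using proper x0 by (simp add: proper_fun_def)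
  ultimately obtain P where P: "\<phi> x0 = ereal P" by (cases "\<phi> x0") auto
  obtain a where a: "a \<ge> 0" "\<And>y. y \<in> Rn n \<Longrightarrow> ereal (P - a * max 1 (vnorm n (y - x0))) \<le> \<phi> y"
    using convex_lsc_linear_lower_bound[OF cvx lsc proper x0(1) P] by blast
  define s where "s = vnorm n (x - x0)"
  define q0 where "q0 = 1/2 * ?Q x0"
  have "0 \<le> c * (vnorm n (x - x0))\<^sup>2" using c(1) by simp
  then have q0: "q0 \<ge> 0" using c(2)[of "x - x0"] by (simp add: q0_def)
  \<comment> \<open>At distance \<open>t \<ge> T\<close> from \<open>x0\<close>,
    \<open>T \<ge> 2 * s\<close> gives \<open>vnorm n (x - y) \<ge> t / 2\<close>, so the quadratic
    term is at least \<open>c / 8 * t\<^sup>2\<close>. \<open>T \<ge> 8 * (a + q0) / c\<close> makes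
    this dominate \<open>q0 + a * t\<close>, and \<open>T \<ge> 1\<close> turns
    \<open>max 1 t\<close> into \<open>t\<close>.\<close>
  define T where "T = 1 + 2 * s + 8 * (a + q0) / c"
  have s: "s \<ge> 0" by (simp add: s_def)
  have T: "T \<ge> 1" "T \<ge> 2 * s" "T \<ge> 8 * (a + q0) / c" "T \<ge> 0"
    using s a(1) q0 c(1) by (auto simp: T_def)
  let ?K = "{y \<in> Rn n. vnorm n (y - x0) \<le> T}"
  have x0K: "x0 \<in> ?K" using x0 T by (simp add: L2_set_def)
  have outside: "h x x0 \<le> h x y" if y: "y \<in> Rn n" "\<not> vnorm n (y - x0) \<le> T" for y
  proof -
    define t where "t = vnorm n (y - x0)"
    have t: "t \<ge> T" using y by (simp add: t_def)
    have "t \<le> vnorm n (x - y) + s"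
    proof -
      have "y - x0 = (x - x0) - (x - y)" by simp
      then show ?thesis using L2_set_diff_le[of "x - x0" "x - y" "{..<n}"]
        by (simp add: t_def s_def)
    qed
    then have "(t / 2)\<^sup>2 \<le> (vnorm n (x - y))\<^sup>2"
      using t T by (intro power_mono) auto
    then have "c * (t / 2)\<^sup>2 \<le> ?Q y" using c by (meson mult_left_mono less_imp_le order_trans)
    then have Qy: "c / 8 * t\<^sup>2 \<le> 1/2 * ?Q y" by (simp add: power2_eq_square)
    have "q0 \<le> t * q0" using q0 t T mult_right_mono[of 1 t q0] by simp
    also have "\<dots> \<le> t * (c / 8 * t - a)"
    proof (rule mult_left_mono)
      have "8 * (a + q0) / c \<le> t" using t T by linarith
      then show "q0 \<le> c / 8 * t - a" using c(1) by (simp add: field_simps)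
    qed (use t T in simp)
    finally have "q0 + a * t \<le> c / 8 * t\<^sup>2" by (simp add: algebra_simps power2_eq_square)
    then have "P + q0 \<le> (P - a * max 1 t) + 1/2 * ?Q y" using Qy t T by (simp add: max_def)
    then have "ereal (P + q0) \<le> \<phi> y + ereal (1/2 * ?Q y)"
      using a(2)[OF y(1), folded t_def] by (cases "\<phi> y") auto
    then show ?thesis unfolding h_def P q0_def by simp
  qed
  have cont: "continuous_on S (\<lambda>y. 1/2 * ?Q y)" for S
    by (rule continuous_on_mult_left[OF continuous_on_quadratic])
  have "\<exists>m\<in>?K. \<forall>y\<in>?K. h x m \<le> h x y"
    unfolding h_def using x0K
    by (intro lsc_attains_inf[OF compactin_closed_ball[OF x0(1)]]
        openin_lsc_add_quadratic[OF lsc cont]) auto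
  then obtain m where m: "m \<in> ?K" "\<And>y. y \<in> ?K \<Longrightarrow> h x m \<le> h x y" by blast
  have "h x m \<le> h x y" if "y \<in> Rn n" for y
    using m(2)[of y] m(2)[OF x0K] outside[of y] that by (cases "vnorm n (y - x0) \<le> T") auto
  then have "is_arg_min (h x) (\<lambda>y. y \<in> Rn n) m"
    using m(1) by (auto simp: is_arg_min_def not_less)
  \<comment> \<open>\<open>prox\<close> is defined by choice among minimizers; as one exists, the
    chosen point is one.\<close>
  then have "is_arg_min (h x) (\<lambda>y. y \<in> Rn n) (Eps (is_arg_min (h x) (\<lambda>y. y \<in> Rn n)))"
    by (rule someI[where P = "is_arg_min (h x) (\<lambda>y. y \<in> Rn n)"])
  then have "is_arg_min (h x) (\<lambda>y. y \<in> Rn n) (prox n \<phi> A x)"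
    unfolding prox_def arg_min_on_def arg_min_def h_def .
  then show "prox n \<phi> A x \<in> Rn n" and "y \<in> Rn n \<Longrightarrow> h x (prox n \<phi> A x) \<le> h x y"
    by (auto simp: is_arg_min_def not_less)
qed

section \<open>Variational inequality and nonexpansiveness\<close>

lemma le_of_le_add_mult_small:
  fixes a b K :: real
  assumes "\<And>t. 0 < t \<Longrightarrow> t \<le> 1 \<Longrightarrow> a \<le> b + t * K"
  shows "a \<le> b"
proof (rule tendsto_le[OF _ _ tendsto_const])
  show "((\<lambda>t. b + t * K) \<longlongrightarrow> b) (at_right 0)"
    by (rule tendsto_eq_intros | simp)+
  show "\<forall>\<^sub>F t in at_right 0. a \<le> b + t * K"
    unfolding eventually_at_right_field using assms by (intro exI[of _ 1]) auto
qed simp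

lemma mat_vec_scale_id: "mat_vec {..<n} (mat_scale c (mat_id {..<n})) x = vscale c (subvec {..<n} x)"
  by (simp add: mat_vec_scale mat_vec_id)

lemma inner_on_mat_scale_id:
  "inner_on {..<n} x (mat_vec {..<n} (mat_scale c (mat_id {..<n})) x) = c * (vnorm n x)\<^sup>2"
  by (simp add: mat_vec_scale_id L2_set_square inner_on_def subvec_def vscale_def
      sum_distrib_left mult_ac)

lemma sym_pos_def_scale_id:
  assumes "c > 0"
  shows "sym_pos_def n (mat_scale c (mat_id {..<n}))"
proof -
  have "vnorm n x \<noteq> 0" if "x \<in> Rn n" "x \<noteq> 0" for x
  proof -
    have "\<exists>i<n. x i \<noteq> 0" using that by (metis Rn_iff ext not_le zero_fun_apply)
    then show ?thesis by (auto simp: L2_set_eq_0_iff)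
  qed
  then show ?thesis
    using assms unfolding sym_pos_def_def inner_on_mat_scale_id
    by (simp add: mat_scale_def mat_id_def)
qed

text \<open>Turns \<open>\<Lambda>\<^sup>-\<^sup>1 v\<close> in the residual into a multiple of
  \<open>v\<close>. Uniqueness for \<open>THE\<close> is read off entrywise, since a multiple of the
  identity only scales entries.\<close>

lemma mat_inverse_scale_id:
  assumes "c > 0"
  shows "mat_inverse n (mat_scale (inverse c) (mat_id {..<n})) = mat_scale c (mat_id {..<n})"
  unfolding mat_inverse_def
proof (rule the_equality)
  have mult: "mat_mult {..<n} (mat_scale a (mat_id {..<n})) B i j = a * B i j" if "i < n" for a B i j
  proof -
    have "(\<Sum>k<n. a * (if i = k \<and> i \<in> {..<n} then 1 else 0) * B k j)
        = (\<Sum>k<n. if k = i then a * B k j else 0)"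
      by (rule sum.cong) (use that in auto)
    then show ?thesis using that by (simp add: mat_mult_def mat_scale_def mat_id_def)
  qed
  let ?A = "mat_scale (inverse c) (mat_id {..<n})"
  show "(\<forall>i j. \<not> (i < n \<and> j < n) \<longrightarrow> mat_scale c (mat_id {..<n}) i j = 0) \<and>
    (\<forall>i<n. \<forall>j<n. mat_mult {..<n} ?A (mat_scale c (mat_id {..<n})) i j = mat_id {..<n} i j \<and>
       mat_mult {..<n} (mat_scale c (mat_id {..<n})) ?A i j = mat_id {..<n} i j)"
    using assms by (auto simp: mult) (auto simp: mat_scale_def mat_id_def)
  fix B
  assume B: "(\<forall>i j. \<not> (i < n \<and> j < n) \<longrightarrow> B i j = 0) \<and>
    (\<forall>i<n. \<forall>j<n. mat_mult {..<n} ?A B i j = mat_id {..<n} i j \<and>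
       mat_mult {..<n} B ?A i j = mat_id {..<n} i j)"
  show "B = mat_scale c (mat_id {..<n})"
  proof (intro ext)
    fix i j
    show "B i j = mat_scale c (mat_id {..<n}) i j"
    proof (cases "i < n \<and> j < n")
      case True
      then have "inverse c * B i j = mat_id {..<n} i j" using B by (simp add: mult)
      then show ?thesis using assms by (simp add: mat_scale_def field_simps)
    next
      case False
      then show ?thesis using B by (auto simp: mat_scale_def mat_id_def)
    qed
  qed
qed

lemma L2_set_diff_scale_square:
  "(L2_set (x - vscale t y) I)\<^sup>2 = (L2_set x I)\<^sup>2 - 2 * t * inner_on I x y + t\<^sup>2 * (L2_set y I)\<^sup>2"
  unfolding L2_set_square inner_on_def vscale_def sum_distrib_left
    sum_subtractf[symmetric] sum.distrib[symmetric]
  by (rule sum.cong) (auto simp: algebra_simps power2_eq_square)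

text \<open>The minimizer \<open>p\<close> is compared with \<open>p + t (y - p)\<close>. Convexity
  bounds \<open>\<phi>\<close> there, the square is expanded, and division by \<open>t\<close>
  leaves a remainder proportional to \<open>t\<close>, which vanishes in the limit. The result says
  that \<open>c (x - p)\<close> is a subgradient of \<open>\<phi>\<close> at
  \<open>p\<close>.\<close>

lemma prox_variational_inequality:
  assumes cvx: "convex_fun n \<phi>" and lsc: "lsc_fun n \<phi>" and proper: "proper_fun n \<phi>"
    and c: "c > 0" and p: "p = prox n \<phi> (mat_scale c (mat_id {..<n})) x"
    and P: "\<phi> p = ereal P" and y: "y \<in> Rn n" "\<phi> y = ereal Y"
  shows "P - Y \<le> - c * inner_on {..<n} (x - p) (y - p)"
proof (rule le_of_le_add_mult_small)
  note min = prox_minimizes[OF cvx lsc proper sym_pos_def_scale_id[OF c], where x = x, folded p]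
  fix t :: real
  assume t: "0 < t" "t \<le> 1"
  let ?w = "vscale (1 - t) p + vscale t y"
  have w: "?w \<in> Rn n" using min(1) y by (simp add: Rn_iff vscale_def)
  have "\<phi> ?w \<le> ereal (1 - t) * \<phi> p + ereal t * \<phi> y"
    using cvx min(1) y(1) t unfolding convex_fun_def by auto
  then have W: "\<phi> ?w \<le> ereal ((1 - t) * P + t * Y)" using P y by simp
  have "x - ?w = (x - p) - vscale t (y - p)"
    by (intro ext) (simp add: vscale_def algebra_simps)
  then have sq: "(vnorm n (x - ?w))\<^sup>2 = (vnorm n (x - p))\<^sup>2
      - 2 * t * inner_on {..<n} (x - p) (y - p) + t\<^sup>2 * (vnorm n (y - p))\<^sup>2"
    by (simp only: L2_set_diff_scale_square)
  have "ereal P + ereal (1/2 * (c * (vnorm n (x - p))\<^sup>2))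
      \<le> \<phi> ?w + ereal (1/2 * (c * (vnorm n (x - ?w))\<^sup>2))"
    using min(2)[OF w] P by (simp only: inner_on_mat_scale_id)
  also have "\<dots> \<le> ereal ((1 - t) * P + t * Y) + ereal (1/2 * (c * (vnorm n (x - ?w))\<^sup>2))"
    by (rule add_right_mono[OF W])
  finally have "P + 1/2 * (c * (vnorm n (x - p))\<^sup>2)
      \<le> (1 - t) * P + t * Y + 1/2 * (c * (vnorm n (x - ?w))\<^sup>2)" by simp
  then have "t * (P - Y) \<le> t * (- c * inner_on {..<n} (x - p) (y - p)
      + t * (c / 2 * (vnorm n (y - p))\<^sup>2))"
    unfolding sq by (simp add: algebra_simps power2_eq_square)
  then show "P - Y \<le> - c * inner_on {..<n} (x - p) (y - p) + t * (c / 2 * (vnorm n (y - p))\<^sup>2)"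
    using t by simp
qed

text \<open>Comparison with a point where \<open>\<phi>\<close> is finite excludes the value
  \<open>\<infinity>\<close>.\<close>

lemma prox_finite:
  assumes cvx: "convex_fun n \<phi>" and lsc: "lsc_fun n \<phi>" and proper: "proper_fun n \<phi>"
    and A: "sym_pos_def n A"
  shows "\<exists>P. \<phi> (prox n \<phi> A x) = ereal P"
proof -
  note min = prox_minimizes[OF cvx lsc proper A, where x = x]
  obtain y where y: "y \<in> Rn n" "\<phi> y \<noteq> \<infinity>" using proper by (auto simp: proper_fun_def)
  have "\<phi> (prox n \<phi> A x) \<noteq> \<infinity>" using min(2)[OF y(1)] y(2) by (cases "\<phi> y") auto
  moreover have "\<phi> (prox n \<phi> A x) \<noteq> -\<infinity>" using proper min(1) by (simp add: proper_fun_def)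
  ultimately show ?thesis by (cases "\<phi> (prox n \<phi> A x)") auto
qed

text \<open>The variational inequality of each proximal point is tested with the other one. In the
  sum the values of \<open>\<phi>\<close> cancel and firm nonexpansiveness remains; Cauchy-Schwarz
  then allows one norm to be cancelled.\<close>

lemma prox_nonexpansive:
  assumes cvx: "convex_fun n \<phi>" and lsc: "lsc_fun n \<phi>" and proper: "proper_fun n \<phi>"
    and c: "c > 0"
  defines "pr \<equiv> prox n \<phi> (mat_scale c (mat_id {..<n}))"
  shows "vnorm n (pr x - pr y) \<le> vnorm n (x - y)"
proof -
  note A = sym_pos_def_scale_id[OF c, of n]
  obtain P Q where PQ: "\<phi> (pr x) = ereal P" "\<phi> (pr y) = ereal Q"
    using prox_finite[OF cvx lsc proper A] unfolding pr_def by meson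
  have Rn: "pr x \<in> Rn n" "pr y \<in> Rn n"
    using prox_minimizes(1)[OF cvx lsc proper A] by (auto simp: pr_def)
  have "P - Q \<le> - c * inner_on {..<n} (x - pr x) (pr y - pr x)"
    "Q - P \<le> - c * inner_on {..<n} (y - pr y) (pr x - pr y)"
    using prox_variational_inequality[OF cvx lsc proper c, of "pr x" x P "pr y" Q]
      prox_variational_inequality[OF cvx lsc proper c, of "pr y" y Q "pr x" P] PQ Rn
    by (auto simp: pr_def)
  then have "c * (inner_on {..<n} (x - pr x) (pr y - pr x)
      + inner_on {..<n} (y - pr y) (pr x - pr y)) \<le> 0" by (simp add: distrib_left)
  then have "inner_on {..<n} (x - pr x) (pr y - pr x)
      + inner_on {..<n} (y - pr y) (pr x - pr y) \<le> 0" using c by (simp add: mult_le_0_iff)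
  moreover have "inner_on {..<n} (x - pr x) (pr y - pr x)
      + inner_on {..<n} (y - pr y) (pr x - pr y)
    = inner_on {..<n} (pr x - pr y) (pr x - pr y) - inner_on {..<n} (x - y) (pr x - pr y)"
    unfolding inner_on_def sum_subtractf[symmetric] sum.distrib[symmetric]
    by (rule sum.cong) (auto simp: algebra_simps)
  ultimately have "(vnorm n (pr x - pr y))\<^sup>2 \<le> inner_on {..<n} (x - y) (pr x - pr y)"
    by (simp add: L2_set_square)
  also have "\<dots> \<le> vnorm n (x - y) * vnorm n (pr x - pr y)"
    using abs_inner_on_le by (rule order_trans[OF abs_ge_self])
  finally have "vnorm n (pr x - pr y) * vnorm n (pr x - pr y)
      \<le> vnorm n (x - y) * vnorm n (pr x - pr y)" by (simp add: power2_eq_square)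
  then show ?thesis
    by (cases "vnorm n (pr x - pr y) = 0") (auto simp: order_less_le)
qed

text \<open>The difference of residuals is \<open>z - x\<close> minus a difference of proximal
  points. By nonexpansiveness the latter is at most the norm of
  \<open>(z - x) - lam (vz - v)\<close>, which gives the factor \<open>1 + l\<close>; the triangle
  inequality adds one more.\<close>

lemma nat_res_lipschitz:
  assumes cvx: "convex_fun n \<phi>" and lsc: "lsc_fun n \<phi>" and proper: "proper_fun n \<phi>"
    and lam: "lam > 0" and \<Lambda>: "\<Lambda> = mat_scale (inverse lam) (mat_id {..<n})"
    and v: "lam * vnorm n (vz - v) \<le> l * vnorm n (z - x)"
  shows "vnorm n (nat_res n \<phi> \<Lambda> vz z - nat_res n \<phi> \<Lambda> v x) \<le> (2 + l) * vnorm n (z - x)"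
proof -
  define g where "g = (\<lambda>v. mat_vec {..<n} (mat_inverse n \<Lambda>) v)"
  define pr where "pr = prox n \<phi> \<Lambda>"
  have g: "g vz - g v = vscale lam (subvec {..<n} (vz - v))"
    unfolding g_def \<Lambda> mat_inverse_scale_id[OF lam] mat_vec_scale_id
    by (intro ext) (simp add: vscale_def subvec_def right_diff_distrib)
  have eq: "nat_res n \<phi> \<Lambda> vz z - nat_res n \<phi> \<Lambda> v x = (z - x) - (pr (z - g vz) - pr (x - g v))"
    by (simp add: nat_res_def g_def pr_def)
  have "vnorm n (pr (z - g vz) - pr (x - g v)) \<le> vnorm n ((z - g vz) - (x - g v))"
    unfolding pr_def \<Lambda> using lam by (intro prox_nonexpansive[OF cvx lsc proper]) simp
  also have "(z - g vz) - (x - g v) = (z - x) - (g vz - g v)" by (simp add: algebra_simps)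
  also have "vnorm n \<dots> \<le> vnorm n (z - x) + vnorm n (g vz - g v)" by (rule L2_set_diff_le)
  also have "vnorm n (g vz - g v) = lam * vnorm n (vz - v)"
    using lam by (simp add: g L2_set_vscale L2_set_subvec)
  finally have "vnorm n (pr (z - g vz) - pr (x - g v)) \<le> (1 + l) * vnorm n (z - x)"
    using v distrib_right[of 1 l "vnorm n (z - x)"] by linarith
  then show ?thesis
    unfolding eq using L2_set_diff_le[of "z - x" "pr (z - g vz) - pr (x - g v)" "{..<n}"]
      distrib_right[of 1 l "vnorm n (z - x)"] distrib_right[of 2 l "vnorm n (z - x)"]
    by linarith
qed

section \<open>The coordinate L-BFGS scheme\<close>

lemma length_used_pairs_le: "length (used_pairs n p \<delta> P k) \<le> p"
  by (simp add: used_pairs_def Let_def)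

lemma in_set_used_pairs:
  assumes "(u, y) \<in> set (used_pairs n p \<delta> P k)"
  shows "\<exists>j<k. (u, y) = P j" and "\<delta> * (vnorm n u)\<^sup>2 \<le> inner_on {..<n} u y"
proof -
  have "(u, y) \<in> set (stored_pairs n \<delta> P k)"
    using assms by (auto simp: used_pairs_def Let_def dest: in_set_dropD)
  then show "\<exists>j<k. (u, y) = P j" and "\<delta> * (vnorm n u)\<^sup>2 \<le> inner_on {..<n} u y"
    by (auto simp: stored_pairs_def)
qed

text \<open>The Lipschitz condition on the oracle speaks of points of \<open>Rn n\<close>, so the
  iterates must be located there. Each \<open>x k\<close> is a starting point or a proximal point.
  For \<open>z k\<close> strong induction applies, because the matrix at \<open>k\<close> is built
  from pairs of earlier iterations.\<close>

lemma iterates_in_Rn: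
  assumes cvx: "convex_fun n \<phi>" and lsc: "lsc_fun n \<phi>" and proper: "proper_fun n \<phi>"
    and \<Lambda>p: "\<And>k. sym_pos_def n (\<Lambda>p k)"
    and step: "extra_step n \<phi> \<alpha> \<beta> \<Lambda>p x z vp d"
    and scheme: "coord_lbfgs_scheme n \<phi> \<Lambda> V p \<delta> \<delta>1 \<delta>2 \<zeta> \<xi> x v z d W"
  shows "x k \<in> Rn n \<and> z k \<in> Rn n"
proof -
  have x: "x k \<in> Rn n" for k
    using step prox_minimizes(1)[OF cvx lsc proper \<Lambda>p]
    by (cases k) (auto simp: extra_step_def dom_fun_def)
  have "z k \<in> Rn n"
  proof (induction k rule: less_induct)
    case (less k)
    define P where "P = (\<lambda>j. curvature_pair n \<phi> (\<Lambda> j) (x j) (v j) (z j) (V (z j) (\<xi> j)))"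
    have W: "W k = coord_lbfgs_matrix n \<delta>1 \<delta>2 (\<zeta> k) (nat_res n \<phi> (\<Lambda> k) (v k) (x k))
        (used_pairs n p \<delta> P k)" and d: "d k = - mat_vec {..<n} (W k) (nat_res n \<phi> (\<Lambda> k) (v k) (x k))"
      using scheme by (auto simp: coord_lbfgs_scheme_def P_def Let_def)
    have "u \<in> Rn n" if "(u, y) \<in> set (used_pairs n p \<delta> P k)" for u y
      using in_set_used_pairs(1)[OF that] less x by (auto simp: P_def curvature_pair_def Rn_iff)
    then have "W k i j = 0" if "n \<le> i" for i j
      unfolding W using that coord_lbfgs_matrix_row_zero by blast
    then have "d k \<in> Rn n" by (simp add: d Rn_iff mat_vec_def)
    moreover have "z k = x k + vscale (\<beta> k) (d k)" using step by (simp add: extra_step_def)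
    ultimately show ?case using x[of k] by (simp add: Rn_iff vscale_def)
  qed
  with x show ?thesis by blast
qed

text \<open>Every used pair belongs to some earlier iteration \<open>j\<close>, with its own step
  size and sample. The product of step size and Lipschitz modulus is bounded by the same
  \<open>l\<close> for all \<open>j\<close>, so one factor \<open>2 + l\<close> fits all
  pairs.\<close>

lemma coord_lbfgs_scheme_bounded:
  assumes cvx: "convex_fun n \<phi>" and lsc: "lsc_fun n \<phi>" and proper: "proper_fun n \<phi>"
    and \<Lambda>p: "\<And>k. sym_pos_def n (\<Lambda>p k)"
    and step: "extra_step n \<phi> \<alpha> \<beta> \<Lambda>p x z vp d"
    and scheme: "coord_lbfgs_scheme n \<phi> \<Lambda> V p \<delta> \<delta>1 \<delta>2 \<zeta> \<xi> x v z d W"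
    and lam: "\<And>k. lam k > 0" and \<Lambda>: "\<And>k. \<Lambda> k = mat_scale (inverse (lam k)) (mat_id {..<n})"
    and v: "\<And>k. v k = V (x k) (\<xi> k)"
    and lip: "\<And>k y. y \<in> Rn n \<Longrightarrow>
      lam k * vnorm n (V y (\<xi> k) - V (x k) (\<xi> k)) \<le> l * vnorm n (y - x k)"
    and pos: "\<delta> > 0" "\<delta>1 > 0" "l > 0" and \<zeta>: "\<And>k. \<bar>\<zeta> k\<bar> \<le> c"
  shows "op_bounded {..<n} (W k) (coord_bound l p (min \<delta> \<delta>1) c)"
proof -
  define P where "P = (\<lambda>j. curvature_pair n \<phi> (\<Lambda> j) (x j) (v j) (z j) (V (z j) (\<xi> j)))"
  have W: "W k = coord_lbfgs_matrix n \<delta>1 \<delta>2 (\<zeta> k) (nat_res n \<phi> (\<Lambda> k) (v k) (x k))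
      (used_pairs n p \<delta> P k)"
    using scheme by (auto simp: coord_lbfgs_scheme_def P_def Let_def)
  have "vnorm n y \<le> (2 + l) * vnorm n u" if used: "(u, y) \<in> set (used_pairs n p \<delta> P k)" for u y
  proof -
    obtain j where j: "(u, y) = P j" using in_set_used_pairs(1)[OF used] by blast
    have "z j \<in> Rn n" using iterates_in_Rn[OF cvx lsc proper \<Lambda>p step scheme] by blast
    then have "vnorm n (nat_res n \<phi> (\<Lambda> j) (V (z j) (\<xi> j)) (z j) - nat_res n \<phi> (\<Lambda> j) (v j) (x j))
        \<le> (2 + l) * vnorm n (z j - x j)"
      using lip by (intro nat_res_lipschitz[OF cvx lsc proper lam[of j] \<Lambda>]) (simp add: v)
    then show ?thesis using j by (simp add: P_def curvature_pair_def)
  qed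
  then show ?thesis
    unfolding W using in_set_used_pairs(2)
    by (intro op_bounded_coord_lbfgs_matrix pos \<zeta> length_used_pairs_le)
qed

text \<open>The quantifier of \<open>\<nu>\<close> precedes those of the dimension, the functions
  and the processes, so the constant is uniform in them. The third argument is
  \<open>min \<delta> \<delta>1\<close> because both curvature tests can be the decisive
  one.\<close>

theorem lemma4p1:
  "\<exists>\<nu> :: real \<Rightarrow> nat \<Rightarrow> real \<Rightarrow> real \<Rightarrow> real.
   \<forall>(l_bar :: real) (p :: nat) (\<delta>1 :: real) (\<zeta>_bar :: real) (\<delta> :: real) (n :: nat)
    (f :: rvec \<Rightarrow> real) (\<phi> :: rvec \<Rightarrow> ereal)
    (M :: 'w measure) (U :: 'u measure) (V :: rvec \<Rightarrow> 'u \<Rightarrow> rvec) (L :: 'u \<Rightarrow> real)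
    (\<Xi> :: nat \<Rightarrow> 'w \<Rightarrow> 'u) (\<Xi>p :: nat \<Rightarrow> 'w \<Rightarrow> 'u)
    (lam :: nat \<Rightarrow> real) (\<Lambda> :: nat \<Rightarrow> rmat) (\<Lambda>p :: nat \<Rightarrow> rmat)
    (\<alpha> :: nat \<Rightarrow> real) (\<beta> :: nat \<Rightarrow> real) (\<zeta> :: nat \<Rightarrow> real)
    (X :: nat \<Rightarrow> 'w \<Rightarrow> rvec) (Z :: nat \<Rightarrow> 'w \<Rightarrow> rvec) (Vk :: nat \<Rightarrow> 'w \<Rightarrow> rvec)
    (Vp :: nat \<Rightarrow> 'w \<Rightarrow> rvec) (D :: nat \<Rightarrow> 'w \<Rightarrow> rvec) (W :: nat \<Rightarrow> 'w \<Rightarrow> rmat).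
     continuously_differentiable n f \<and>
     convex_fun n \<phi> \<and> lsc_fun n \<phi> \<and> proper_fun n \<phi> \<and>
     prob_space M \<and>
     (\<forall>k. lam k > 0 \<and> \<Lambda> k = mat_scale (inverse (lam k)) (mat_id {..<n})) \<and>
     (\<forall>k. \<alpha> k \<ge> 0 \<and> \<beta> k \<ge> 0 \<and> sym_pos_def n (\<Lambda>p k)) \<and>
     \<delta> > 0 \<and> \<delta>1 > 0 \<and> (\<forall>k. \<zeta> k > 0) \<and>
     X 0 \<in> borel_measurable M \<and>
     (\<forall>\<omega>\<in>space M.
        extra_step n \<phi> \<alpha> \<beta> \<Lambda>p (\<lambda>k. X k \<omega>) (\<lambda>k. Z k \<omega>) (\<lambda>k. Vp k \<omega>) (\<lambda>k. D k \<omega>) \<and>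
        coord_lbfgs_scheme n \<phi> \<Lambda> V p \<delta> \<delta>1 (1 / 10 ^ 6) \<zeta>
          (\<lambda>k. \<Xi> k \<omega>) (\<lambda>k. X k \<omega>) (\<lambda>k. Vk k \<omega>) (\<lambda>k. Z k \<omega>) (\<lambda>k. D k \<omega>) (\<lambda>k. W k \<omega>)) \<and>
     caratheodory n U V \<and>
     (\<forall>k. \<Xi> k \<in> measurable M U \<and> \<Xi>p k \<in> measurable M U) \<and>
     (\<forall>k. \<forall>\<omega>\<in>space M. Vk k \<omega> = V (X k \<omega>) (\<Xi> k \<omega>) \<and> Vp k \<omega> = V (Z k \<omega>) (\<Xi>p k \<omega>)) \<and>
     L \<in> borel_measurable U \<and> l_bar > 0 \<and>
     (\<forall>u\<in>space U. \<forall>x\<in>Rn n. \<forall>y\<in>Rn n. vnorm n (V x u - V y u) \<le> L u * vnorm n (x - y)) \<and>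
     (AE \<omega> in M. (SUP k. ereal (lam k * L (\<Xi> k \<omega>))) \<le> ereal l_bar) \<and>
     \<zeta>_bar > 0 \<and> (\<forall>k. \<bar>\<zeta> k\<bar> \<le> \<zeta>_bar)
     \<longrightarrow>
     (AE \<omega> in M. \<forall>k.
        spectral_norm n (W k \<omega>) \<le> \<nu> l_bar p (min \<delta> \<delta>1) \<zeta>_bar \<and>
        vnorm n (D k \<omega>)
          \<le> \<nu> l_bar p (min \<delta> \<delta>1) \<zeta>_bar * vnorm n (nat_res n \<phi> (\<Lambda> k) (Vk k \<omega>) (X k \<omega>)))"
proof (intro exI[of _ coord_bound] allI impI, elim conjE)
  fix l_bar p \<delta>1 \<zeta>_bar \<delta> n and f :: "rvec \<Rightarrow> real" and \<phi>
    and M :: "'w measure" and U :: "'u measure" and V L \<Xi> \<Xi>p lam \<Lambda> \<Lambda>p \<alpha> \<beta> \<zeta> X Z Vk Vp D W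
  let ?\<nu> = "coord_bound l_bar p (min \<delta> \<delta>1) \<zeta>_bar"
  assume \<phi>: "convex_fun n \<phi>" "lsc_fun n \<phi>" "proper_fun n \<phi>"
    and lam: "\<forall>k. 0 < lam k \<and> \<Lambda> k = mat_scale (inverse (lam k)) (mat_id {..<n})"
    and \<Lambda>p: "\<forall>k. 0 \<le> \<alpha> k \<and> 0 \<le> \<beta> k \<and> sym_pos_def n (\<Lambda>p k)"
    and pos: "0 < \<delta>" "0 < \<delta>1" "0 < l_bar"
    and alg: "\<forall>\<omega>\<in>space M.
        extra_step n \<phi> \<alpha> \<beta> \<Lambda>p (\<lambda>k. X k \<omega>) (\<lambda>k. Z k \<omega>) (\<lambda>k. Vp k \<omega>) (\<lambda>k. D k \<omega>) \<and>
        coord_lbfgs_scheme n \<phi> \<Lambda> V p \<delta> \<delta>1 (1 / 10 ^ 6) \<zeta>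
          (\<lambda>k. \<Xi> k \<omega>) (\<lambda>k. X k \<omega>) (\<lambda>k. Vk k \<omega>) (\<lambda>k. Z k \<omega>) (\<lambda>k. D k \<omega>) (\<lambda>k. W k \<omega>)"
    and \<Xi>: "\<forall>k. \<Xi> k \<in> measurable M U \<and> \<Xi>p k \<in> measurable M U"
    and Vk: "\<forall>k. \<forall>\<omega>\<in>space M. Vk k \<omega> = V (X k \<omega>) (\<Xi> k \<omega>) \<and> Vp k \<omega> = V (Z k \<omega>) (\<Xi>p k \<omega>)"
    and L: "\<forall>u\<in>space U. \<forall>x\<in>Rn n. \<forall>y\<in>Rn n. vnorm n (V x u - V y u) \<le> L u * vnorm n (x - y)"
    and l_bar: "AE \<omega> in M. (SUP k. ereal (lam k * L (\<Xi> k \<omega>))) \<le> ereal l_bar"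
    and \<zeta>: "\<forall>k. \<bar>\<zeta> k\<bar> \<le> \<zeta>_bar"
  show "AE \<omega> in M. \<forall>k. spectral_norm n (W k \<omega>) \<le> ?\<nu> \<and>
      vnorm n (D k \<omega>) \<le> ?\<nu> * vnorm n (nat_res n \<phi> (\<Lambda> k) (Vk k \<omega>) (X k \<omega>))"
    \<comment> \<open>The bound on the supremum is the only condition imposed almost surely. For a
      fixed \<open>\<omega>\<close> that satisfies it, the rest is deterministic and covers all
      \<open>k\<close> at once.\<close>
    using l_bar AE_space
  proof eventually_elim
    case (elim \<omega>)
    note step = alg[rule_format, OF elim(2), THEN conjunct1]
    note scheme = alg[rule_format, OF elim(2), THEN conjunct2]
    have "lam k * vnorm n (V y (\<Xi> k \<omega>) - V (X k \<omega>) (\<Xi> k \<omega>)) \<le> l_bar * vnorm n (y - X k \<omega>)"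
      if y: "y \<in> Rn n" for k y
    proof -
      have "ereal (lam k * L (\<Xi> k \<omega>)) \<le> ereal l_bar"
        using elim(1) by (meson SUP_upper UNIV_I order_trans)
      then have l: "lam k * L (\<Xi> k \<omega>) \<le> l_bar" by simp
      have "\<Xi> k \<omega> \<in> space U" using \<Xi> elim(2) by (meson measurable_space)
      moreover have "X k \<omega> \<in> Rn n"
        using iterates_in_Rn[OF \<phi> _ step scheme] \<Lambda>p by blast
      ultimately have "vnorm n (V y (\<Xi> k \<omega>) - V (X k \<omega>) (\<Xi> k \<omega>)) \<le> L (\<Xi> k \<omega>) * vnorm n (y - X k \<omega>)"
        using L y by blast
      then have "lam k * vnorm n (V y (\<Xi> k \<omega>) - V (X k \<omega>) (\<Xi> k \<omega>))
          \<le> lam k * (L (\<Xi> k \<omega>) * vnorm n (y - X k \<omega>))"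
        using lam by (intro mult_left_mono) (auto intro: less_imp_le)
      also have "\<dots> \<le> l_bar * vnorm n (y - X k \<omega>)"
        unfolding mult.assoc[symmetric] by (rule mult_right_mono[OF l L2_set_nonneg])
      finally show ?thesis .
    qed
    then have W: "op_bounded {..<n} (W k \<omega>) ?\<nu>" for k
      using coord_lbfgs_scheme_bounded[OF \<phi> _ step scheme _ _ _ _ pos, of lam \<zeta>_bar k]
        \<Lambda>p lam Vk elim(2) \<zeta> by blast
    have "D k \<omega> = - mat_vec {..<n} (W k \<omega>) (nat_res n \<phi> (\<Lambda> k) (Vk k \<omega>) (X k \<omega>))" for k
      using scheme by (simp add: coord_lbfgs_scheme_def Let_def)
    then show ?case
      using W spectral_norm_le[OF W] by (simp add: L2_set_uminus op_bounded_def)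
  qed
qed

end
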